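(* Let $H_0$ be a self-adjoint operator on a Hilbert space $\mathcal H$ with discrete non-degenerate spectrum $\{E_0(n): n\in J\}$, $J\subseteq\mathbb N$, and orthonormal eigenbasis $(e_n)_{n\in J}$, and let $V$ be a bounded self-adjoint operator which is finite-band, i.e. only finitely many of its homogeneous components $V_\lambda$ ($\lambda\in\mathcal N$) are nonzero. Let $N_k$ ($k\ge1$) be the order-$k$ term of the Rayleigh–Schrödinger normal form of $H_0+V$, as defined in the context. Then for every $k\ge 1$, $$N_k=\sum_{\lambda_1,\dots,\lambda_k\in\mathcal N} N^{\lambda_1\cdots\lambda_k}\ \tfrac1{i\hbar}\big[V_{\lambda_1},\tfrac1{i\hbar}[V_{\lambda_2},\dots,\tfrac1{i\hbar}[V_{\lambda_{k-1}},V_{\lambda_k}]\dots]\big]$$ (for $k=1$ the nested commutator is $V_{\lambda_1}$ itself), with $$N^{\lambda_1\cdots\lambda_k} = -\,\text{residue of } U_-^{\lambda_1\cdots\lambda_k} = -\big[\varepsilon\, U_-^{\lambda_1\cdots\lambda_k}(\varepsilon)\big]_{\varepsilon=\infty},$$ where $U_-$ is the polar part in the Birkhoff decomposition of the mould $$T^{\lambda_1\cdots\lambda_r}(\varepsilon)=\frac1{(\lambda_1+\varepsilon)(\lambda_1+\lambda_2+2\varepsilon)\cdots(\lambda_1+\cdots+\lambda_r+r\varepsilon)}.$$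
   Context: Here $\hbar>0$ is fixed and the inner product $(\cdot,\cdot)$ is linear in its second argument; $H_0e_n=E_0(n)e_n$. Homogeneous components: $\mathcal N=\{\frac1{i\hbar}(E_0(\ell)-E_0(k)) : k,\ell\in J\}\subset i\mathbb R$. For $\lambda\in\mathcal N$, $$V_\lambda=\sum_{(k,\ell):\,E_0(\ell)-E_0(k)=i\hbar\lambda}(e_\ell,Ve_k)\,(e_k,\cdot\,)\,e_\ell ,$$ so that $\frac1{i\hbar}[H_0,V_\lambda]=\lambda V_\lambda$ and $V=\sum_{\lambda\in\mathcal N}V_\lambda$ (a finite sum by the finite-band hypothesis). Square brackets $[\cdot,\cdot]$ are commutators. All operators are considered on the dense subspace $\mathrm{Span}_{\mathbb C}\{e_n\}$, which $H_0$ and $V$ preserve. Normal form: with a formal parameter $\mu$ counting powers of $V$, consider formal series $W=\sum_{k\ge1}\mu^kW_k$ and $N=\sum_{k\ge1}\mu^kN_k$ whose coefficients are symmetric operators preserving $\mathrm{Span}_{\mathbb C}\{e_n\}$, such that, as formal power series in $\mu$, $$e^{\frac1{i\hbar}W}(H_0+\mu V)e^{-\frac1{i\hbar}W}=H_0+N,\qquad [H_0,N_k]=0\ \text{ for all }k\ge 1 .$$ Such $W,N$ exist and are obtained recursively: at order $k$ one has $\frac1{i\hbar}[H_0,W_k]+N_k=V_k$ with $V_1=V$ and, for $k\ge2$, $V_k$ the expression in $H_0,V,W_1,\dots,W_{k-1}$ obtained by expanding the conjugation in iterated commutators; it is solved by taking $N_k$ to be the diagonal part of $V_k$ in the basis $(e_n)$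 and $(e_n,W_ke_m)=\frac{i\hbar}{E_0(n)-E_0(m)}(e_n,V_ke_m)$ for $n\ne m$. The $N_k$ do not depend on the choice of the diagonal parts of the $W_k$ (the $N_k$ are uniquely determined). Moulds and Birkhoff decomposition: $\underline{\mathcal N}$ is the set of words (finite sequences, including the empty word $\varnothing$) on the alphabet $\mathcal N$. Let $K=\mathbb C((\varepsilon))=K_+\oplus K_-$ with $K_+=\mathbb C[[\varepsilon]]$, $K_-=\varepsilon^{-1}\mathbb C[\varepsilon^{-1}]$. A $K$-valued mould is a function $M:\underline{\mathcal N}\to K$, $\underline\lambda\mapsto M^{\underline\lambda}$; moulds are multiplied by $(M\times M')^{\underline\lambda}=\sum_{\underline a\,\underline b=\underline\lambda}M^{\underline a}M'^{\underline b}$ (sum over all ways to write $\underline\lambda$ as a concatenation, empty factors allowed), with unit $\mathbf 1$ given by $\mathbf 1^{\varnothing}=1$, $\mathbf 1^{\underline\lambda}=0$ for $\underline\lambda\neq\varnothing$. $T$ is the $K$-valued mould in the claim, with $T^\varnothing=1$. Its Birkhoff decomposition is the unique pair $(U_+,U_-)$ of $K$-valued moulds with $U_\pm^\varnothing=1$, $U_-^{\underline\lambda}\in K_-$ and $U_+^{\underline\lambda}\in K_+$ for every nonempty $\underline\lambda$, and $U_-\times T=U_+$. The residue of a Laurent series $\sum_n c_n\varepsilon^n$ is $c_{-1}$; evaluation at $\varepsilon=\infty$ of an element of $\mathbb C[\varepsilon^{-1}]$ means taking its constant term. *)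

theory Defs
  imports "HOL-Analysis.Analysis" "HOL-Computational_Algebra.Formal_Laurent_Series"
begin

unbundle fps_syntax

section \<open>Complex Hilbert spaces\<close>

text \<open>The inner product is linear in its second argument.\<close>

class chilbert_space = banach +
  fixes scaleC :: "complex \<Rightarrow> 'a \<Rightarrow> 'a" (infixr "*\<^sub>C" 75)
    and cinner :: "'a \<Rightarrow> 'a \<Rightarrow> complex"
  assumes scaleR_scaleC: "r *\<^sub>R x = complex_of_real r *\<^sub>C x"
    and scaleC_add_right: "a *\<^sub>C (x + y) = a *\<^sub>C x + a *\<^sub>C y"
    and scaleC_add_left: "(a + b) *\<^sub>C x = a *\<^sub>C x + b *\<^sub>C x"
    and scaleC_scaleC: "a *\<^sub>C b *\<^sub>C x = (a * b) *\<^sub>C x"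
    and cinner_commute: "cinner x y = cnj (cinner y x)"
    and cinner_add_right: "cinner x (y + z) = cinner x y + cinner x z"
    and cinner_scaleC_right: "cinner x (a *\<^sub>C y) = a * cinner x y"
    and cinner_self: "cinner x x = complex_of_real ((norm x)\<^sup>2)"

global_interpretation complex_vector: vector_space "scaleC :: complex \<Rightarrow> 'a \<Rightarrow> 'a::chilbert_space"
  defines cspan = complex_vector.span
    and csubspace = complex_vector.subspace
proof unfold_locales
  show "1 *\<^sub>C x = x" for x :: 'a
    using scaleR_scaleC[of 1 x] by simp
qed (simp_all add: scaleC_add_right scaleC_add_left scaleC_scaleC)

definition clinear_on :: "'h::chilbert_space set \<Rightarrow> ('h \<Rightarrow> 'h) \<Rightarrow> bool" where
  "clinear_on S A \<longleftrightarrow>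
     (\<forall>x\<in>S. \<forall>y\<in>S. A (x + y) = A x + A y) \<and> (\<forall>c. \<forall>x\<in>S. A (c *\<^sub>C x) = c *\<^sub>C A x)"

definition symmetric_on :: "'h::chilbert_space set \<Rightarrow> ('h \<Rightarrow> 'h) \<Rightarrow> bool" where
  "symmetric_on S A \<longleftrightarrow> (\<forall>x\<in>S. \<forall>y\<in>S. cinner (A x) y = cinner x (A y))"

text \<open>
  An unbounded operator is a pair of a domain \<open>D\<close> and a total function whose values outside
  \<open>D\<close> are irrelevant. The last conjunct says that the graph of \<open>A\<close> on \<open>D\<close> is exactly the graph
  of the adjoint.
\<close>

definition self_adjoint_on :: "'h::chilbert_space set \<Rightarrow> ('h \<Rightarrow> 'h) \<Rightarrow> bool" where
  "self_adjoint_on D A \<longleftrightarrow>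
     csubspace D \<and> closure D = UNIV \<and> clinear_on D A \<and>
     (\<forall>y z. (y \<in> D \<and> A y = z) \<longleftrightarrow> (\<forall>x\<in>D. cinner y (A x) = cinner z x))"

definition op_spectrum :: "'h::chilbert_space set \<Rightarrow> ('h \<Rightarrow> 'h) \<Rightarrow> complex set" where
  "op_spectrum D A = {z. \<not> (bij_betw (\<lambda>x. A x - z *\<^sub>C x) D UNIV \<and>
     (\<exists>C. \<forall>x\<in>D. norm x \<le> C * norm (A x - z *\<^sub>C x)))}"

definition bounded_self_adjoint :: "('h::chilbert_space \<Rightarrow> 'h) \<Rightarrow> bool" where
  "bounded_self_adjoint A \<longleftrightarrow> bounded_linear A \<and> clinear_on UNIV A \<and> symmetric_on UNIV A"

definition orthonormal_basis_on :: "nat set \<Rightarrow> (nat \<Rightarrow> 'h::chilbert_space) \<Rightarrow> bool" where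
  "orthonormal_basis_on J e \<longleftrightarrow>
     (\<forall>m\<in>J. \<forall>n\<in>J. cinner (e m) (e n) = (if m = n then 1 else 0)) \<and>
     closure (cspan (e ` J)) = UNIV"

text \<open>
  Discrete: the spectrum consists of the eigenvalues \<open>E0 n\<close> only, all of them isolated.
  Non-degenerate: distinct indices have distinct eigenvalues.
\<close>

definition discrete_nondegenerate_spectrum ::
  "'h::chilbert_space set \<Rightarrow> ('h \<Rightarrow> 'h) \<Rightarrow> nat set \<Rightarrow> (nat \<Rightarrow> real) \<Rightarrow> (nat \<Rightarrow> 'h) \<Rightarrow> bool" where
  "discrete_nondegenerate_spectrum D H0 J E0 e \<longleftrightarrow>
     op_spectrum D H0 = (\<lambda>n. complex_of_real (E0 n)) ` J \<and>
     discrete (op_spectrum D H0) \<and> inj_on E0 J \<and>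
     orthonormal_basis_on J e \<and>
     (\<forall>n\<in>J. e n \<in> D \<and> H0 (e n) = complex_of_real (E0 n) *\<^sub>C e n)"


section \<open>Homogeneous components and commutators\<close>

definition frequencies :: "real \<Rightarrow> nat set \<Rightarrow> (nat \<Rightarrow> real) \<Rightarrow> complex set" where
  "frequencies hbar J E0 =
     {1 / (\<i> * complex_of_real hbar) * complex_of_real (E0 l - E0 k) | k l. k \<in> J \<and> l \<in> J}"

text \<open>On the span of the basis only finitely many terms of this sum are nonzero.\<close>

definition hom_component ::
  "real \<Rightarrow> nat set \<Rightarrow> (nat \<Rightarrow> real) \<Rightarrow> (nat \<Rightarrow> 'h::chilbert_space) \<Rightarrow> ('h \<Rightarrow> 'h) \<Rightarrow> complex \<Rightarrow> 'h \<Rightarrow> 'h"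
  where
  "hom_component hbar J E0 e V lam x =
     (\<Sum>\<^sub>\<infinity>(k, l) \<in> {(k, l). k \<in> J \<and> l \<in> J \<and>
          complex_of_real (E0 l - E0 k) = \<i> * complex_of_real hbar * lam}.
        (cinner (e l) (V (e k)) * cinner (e k) x) *\<^sub>C e l)"

definition commutator :: "('h::chilbert_space \<Rightarrow> 'h) \<Rightarrow> ('h \<Rightarrow> 'h) \<Rightarrow> 'h \<Rightarrow> 'h" where
  "commutator A B x = A (B x) - B (A x)"

fun nested_commutator :: "real \<Rightarrow> ('h::chilbert_space \<Rightarrow> 'h) list \<Rightarrow> 'h \<Rightarrow> 'h" where
  "nested_commutator hbar [] = (\<lambda>x. 0)"
| "nested_commutator hbar [A] = A"
| "nested_commutator hbar (A # B # As) =
     (\<lambda>x. (1 / (\<i> * complex_of_real hbar)) *\<^sub>C commutator A (nested_commutator hbar (B # As)) x)"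


section \<open>Formal power series of operators and the normal form\<close>

text \<open>
  A formal power series in \<open>\<mu>\<close> with operator coefficients is the sequence of its coefficients.
  Equality of series is tested on the span of the basis only.
\<close>

type_synonym 'h opseries = "nat \<Rightarrow> 'h \<Rightarrow> 'h"

definition ser_one :: "'h::chilbert_space opseries" where
  "ser_one n x = (if n = 0 then x else 0)"

definition ser_scale :: "complex \<Rightarrow> 'h::chilbert_space opseries \<Rightarrow> 'h opseries" where
  "ser_scale c A n x = c *\<^sub>C A n x"

definition ser_mult :: "'h::chilbert_space opseries \<Rightarrow> 'h opseries \<Rightarrow> 'h opseries" where
  "ser_mult A B n x = (\<Sum>i\<le>n. A i (B (n - i) x))"

fun ser_power :: "'h::chilbert_space opseries \<Rightarrow> nat \<Rightarrow> 'h opseries" where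
  "ser_power A 0 = ser_one"
| "ser_power A (Suc j) = ser_mult A (ser_power A j)"

text \<open>
  The exponential of a series without constant term: its \<open>j\<close>-th power has no terms of order
  below \<open>j\<close>, so the coefficient of order \<open>n\<close> involves the powers \<open>j \<le> n\<close> only.
\<close>

definition ser_exp :: "'h::chilbert_space opseries \<Rightarrow> 'h opseries" where
  "ser_exp A n x = (\<Sum>j\<le>n. (1 / fact j) *\<^sub>C ser_power A j n x)"

definition perturbed_series :: "('h::chilbert_space \<Rightarrow> 'h) \<Rightarrow> ('h \<Rightarrow> 'h) \<Rightarrow> 'h opseries" where
  "perturbed_series H0 V n = (if n = 0 then H0 else if n = 1 then V else (\<lambda>x. 0))"

text \<open>
  \<open>S\<close> is the span of the eigenbasis; \<open>W 0\<close> and \<open>N 0\<close> vanish because the series start at order 1.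
\<close>

definition is_normal_form ::
  "real \<Rightarrow> 'h::chilbert_space set \<Rightarrow> ('h \<Rightarrow> 'h) \<Rightarrow> ('h \<Rightarrow> 'h) \<Rightarrow> 'h opseries \<Rightarrow> 'h opseries \<Rightarrow> bool"
  where
  "is_normal_form hbar S H0 V W N \<longleftrightarrow>
     (\<forall>x. W 0 x = 0 \<and> N 0 x = 0) \<and>
     (\<forall>k\<ge>1. clinear_on S (W k) \<and> symmetric_on S (W k) \<and> W k ` S \<subseteq> S) \<and>
     (\<forall>k\<ge>1. clinear_on S (N k) \<and> symmetric_on S (N k) \<and> N k ` S \<subseteq> S) \<and>
     (\<forall>n. \<forall>x\<in>S.
        ser_mult (ser_mult (ser_exp (ser_scale (1 / (\<i> * complex_of_real hbar)) W))
                           (perturbed_series H0 V))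
                 (ser_exp (ser_scale (- 1 / (\<i> * complex_of_real hbar)) W)) n x
        = (if n = 0 then H0 x else N n x)) \<and>
     (\<forall>k\<ge>1. \<forall>x\<in>S. commutator H0 (N k) x = 0)"


section \<open>Moulds and Birkhoff decomposition\<close>

text \<open>
  Words are lists of letters; a mould on an alphabet \<open>\<N>\<close> is only considered on \<open>lists \<N>\<close>.
  The indeterminate \<open>\<epsilon>\<close> of the Laurent series is \<^const>\<open>fls_X\<close>.
\<close>

type_synonym mould = "complex list \<Rightarrow> complex fls"

definition mould_mult :: "mould \<Rightarrow> mould \<Rightarrow> mould" where
  "mould_mult M M' w = (\<Sum>i\<le>length w. M (take i w) * M' (drop i w))"

definition K_plus :: "complex fls set" where
  "K_plus = {f. \<forall>n<0. f $$ n = 0}"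

definition K_minus :: "complex fls set" where
  "K_minus = {f. \<forall>n\<ge>0. f $$ n = 0}"

definition T_mould :: mould where
  "T_mould w =
     1 / (\<Prod>j=1..length w. fls_const (sum_list (take j w)) + of_nat j * fls_X)"

definition is_birkhoff_decomposition :: "complex set \<Rightarrow> mould \<Rightarrow> mould \<Rightarrow> mould \<Rightarrow> bool" where
  "is_birkhoff_decomposition Alph T Uplus Uminus \<longleftrightarrow>
     Uplus [] = 1 \<and> Uminus [] = 1 \<and>
     (\<forall>w\<in>lists Alph. w \<noteq> [] \<longrightarrow> Uminus w \<in> K_minus \<and> Uplus w \<in> K_plus) \<and>
     (\<forall>w\<in>lists Alph. mould_mult Uminus T w = Uplus w)"

text \<open>Evaluation at \<open>\<epsilon> = \<infinity>\<close>, meaningful for elements of \<open>\<complex>[\<epsilon>\<^sup>-\<^sup>1]\<close>.\<close>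

definition eval_at_infinity :: "complex fls \<Rightarrow> complex" where
  "eval_at_infinity f = f $$ 0"

end

theory Submission
  imports Defs
begin

text \<open>
  Let \<open>\<nabla>\<close> multiply the coefficient of a word \<open>w\<close> by the sum of its letters and let \<open>L\<close> multiply it
  by the length of \<open>w\<close>. The mould \<open>T\<close> solves \<open>(\<nabla> + \<epsilon> L) T = T \<times> I\<close>, where \<open>I\<close> is the indicator of the
  one-letter words. Let \<open>\<Phi> = - L res U\<^sub>-\<close>. Then \<open>(\<nabla> + \<epsilon> L) U\<^sub>- + \<Phi> \<times> U\<^sub>-\<close> is polar while its product
  with \<open>T\<close> is regular, so it vanishes. This gives \<open>\<nabla> \<Phi> = 0\<close>, and taking the coefficient of \<open>\<epsilon>\<^sup>0\<close>
  in \<open>(\<nabla> + \<epsilon> L) U\<^sub>+ = U\<^sub>+ \<times> I - \<Phi> \<times> U\<^sub>+\<close> gives \<open>\<nabla> G = G \<times> I - \<Phi> \<times> G\<close> for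
  \<open>G = U\<^sub>+|\<^bsub>\<epsilon>=0\<^esub>\<close>. Substituting the operators \<open>V\<^sub>\<lambda>/(i\<hbar>)\<close> for the letters, \<open>G\<close> conjugates
  \<open>H\<^sub>0 + \<mu>V\<close> to \<open>H\<^sub>0\<close> plus a series commuting with \<open>H\<^sub>0\<close>, and such a normal form is unique because
  the spectrum is simple. Finally \<open>T\<close> is symmetral, hence so is \<open>U\<^sub>-\<close> by uniqueness of the Birkhoff
  decomposition; a product of two elements of \<open>K\<^sub>-\<close> has no residue, so \<open>\<Phi>\<close> is alternal, and the
  Dynkin--Specht--Wever identity turns products of \<open>V\<^sub>\<lambda>\<close> into nested commutators divided by the length.
\<close>

section \<open>Moulds and shuffles\<close>

text \<open>\<open>mould_mult\<close> over an arbitrary alphabet and ring: products of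
  complex-valued and operator-valued moulds occur as well as those of Laurent series.\<close>

definition cmul :: "('a list \<Rightarrow> 'b::ring_1) \<Rightarrow> ('a list \<Rightarrow> 'b) \<Rightarrow> 'a list \<Rightarrow> 'b" where
  "cmul M M' w = (\<Sum>i\<le>length w. M (take i w) * M' (drop i w))"

definition letter_mould :: "'a list \<Rightarrow> 'b::ring_1" where
  "letter_mould w = (if length w = 1 then 1 else 0)"

definition unit_mould :: "'a list \<Rightarrow> 'b::ring_1" where
  "unit_mould w = (if w = [] then 1 else 0)"

lemma mould_mult_eq_cmul: "mould_mult = cmul"
  by (intro ext) (simp add: mould_mult_def cmul_def)

lemma cmul_Nil [simp]: "cmul M M' [] = M [] * M' []"
  by (simp add: cmul_def)

text \<open>Unless the left factor is empty, it starts with \<open>a\<close>. This drives the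
  inductions on words, in which the left mould has to vary.\<close>

lemma cmul_Cons: "cmul M M' (a # w) = M [] * M' (a # w) + cmul (\<lambda>u. M (a # u)) M' w"
  by (simp add: cmul_def sum.atMost_Suc_shift del: sum.atMost_Suc)

lemma cmul_add_left: "cmul (\<lambda>u. M u + N u) M' w = cmul M M' w + cmul N M' w"
  by (simp add: cmul_def distrib_right sum.distrib)

lemma cmul_scale_left: "cmul (\<lambda>u. c * M u) M' w = c * cmul M M' w"
  by (simp add: cmul_def sum_distrib_left mult.assoc)

lemma cmul_assoc: "cmul (cmul M M') M'' w = cmul M (cmul M' M'') w"
  by (induction w arbitrary: M)
     (simp_all add: cmul_Cons cmul_add_left cmul_scale_left mult.assoc distrib_left add.assoc)

lemma cmul_cong_lists:
  assumes "\<And>u. u \<in> lists A \<Longrightarrow> M u = N u" "\<And>u. u \<in> lists A \<Longrightarrow> M' u = N' u" "w \<in> lists A"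
  shows "cmul M M' w = cmul N N' w"
proof -
  have "take i w \<in> lists A" "drop i w \<in> lists A" for i
    using assms(3) by (auto simp: in_lists_conv_set dest: in_set_takeD in_set_dropD)
  then show ?thesis using assms(1,2) by (simp add: cmul_def)
qed

lemma cmul_unit_right [simp]: "cmul M unit_mould w = M w"
  by (induction w arbitrary: M) (simp_all add: cmul_Cons unit_mould_def)

lemma cmul_letter_right: "cmul M letter_mould w = (if w = [] then 0 else M (butlast w))"
proof (induction w arbitrary: M)
  case (Cons a w)
  show ?case
    by (auto simp: cmul_Cons Cons.IH) (auto simp: letter_mould_def)
qed (simp add: letter_mould_def)

text \<open>In each term of the product the weight of \<open>w\<close> is the sum of the weights of
  its two pieces. This is the Leibniz rule later applied to \<nabla> + \<epsilon> L.\<close>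

lemma cmul_derivation:
  assumes g: "\<And>u v. g (u @ v) = g u + (g v :: 'b::comm_ring_1)"
  shows "g w * cmul M M' w = cmul (\<lambda>u. g u * M u) M' w + cmul M (\<lambda>u. g u * M' u) w"
proof -
  have "g w * (M (take i w) * M' (drop i w)) =
        g (take i w) * M (take i w) * M' (drop i w) + M (take i w) * (g (drop i w) * M' (drop i w))" for i
    using g[of "take i w" "drop i w"] by (simp add: algebra_simps)
  then show ?thesis
    by (simp add: cmul_def sum_distrib_left sum.distrib)
qed

section \<open>Sums over shuffles and their compatibility with the mould product\<close>

text \<open>The pairing of \<open>M\<close> with the shuffle product of the two words, interleavings
  counted with multiplicity. The recursion reads off the first letter of the interleaving and stores
  it in the mould.\<close>

fun shuffle_sum :: "('a list \<Rightarrow> 'b::ring_1) \<Rightarrow> 'a list \<Rightarrow> 'a list \<Rightarrow> 'b" where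
  "shuffle_sum M [] v = M v"
| "shuffle_sum M (a # u) [] = M (a # u)"
| "shuffle_sum M (a # u) (b # v) =
     shuffle_sum (\<lambda>w. M (a # w)) u (b # v) + shuffle_sum (\<lambda>w. M (b # w)) (a # u) v"

lemma shuffle_sum_Nil_right [simp]: "shuffle_sum M u [] = M u"
  by (cases u) auto

lemma shuffle_sum_Nil_left: "shuffle_sum M [] = M"
  by (intro ext) simp

lemma shuffle_sum_add: "shuffle_sum (\<lambda>w. M w + N w) u v = shuffle_sum M u v + shuffle_sum N u v"
proof (induction M u v arbitrary: N rule: shuffle_sum.induct)
  case (3 M a u b v)
  then show ?case by (simp only: shuffle_sum.simps) simp
qed simp_all

lemma shuffle_sum_hom:
  assumes "f 0 = 0" "\<And>x y. f (x + y) = f x + f y"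
  shows "shuffle_sum (\<lambda>w. f (M w)) u v = f (shuffle_sum M u v)"
  by (induction M u v rule: shuffle_sum.induct) (simp_all add: assms)

lemma shuffle_sum_scale: "shuffle_sum (\<lambda>w. c * M w) u v = c * shuffle_sum M u v"
  by (rule shuffle_sum_hom) (simp_all add: distrib_left)

lemma shuffle_sum_zero [simp]: "shuffle_sum (\<lambda>w. 0) u v = 0"
  using shuffle_sum_scale[of 0 "\<lambda>w. 0" u v] by simp

lemma shuffle_sum_cong:
  assumes "\<And>w. set w \<subseteq> set u \<union> set v \<Longrightarrow> M w = N w"
  shows "shuffle_sum M u v = shuffle_sum N u v"
  using assms
proof (induction M u v arbitrary: N rule: shuffle_sum.induct)
  case (3 M a u b v)
  have "shuffle_sum (\<lambda>w. M (a # w)) u (b # v) = shuffle_sum (\<lambda>w. N (a # w)) u (b # v)"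
    by (rule 3(1), rule 3(3)) auto
  moreover have "shuffle_sum (\<lambda>w. M (b # w)) (a # u) v = shuffle_sum (\<lambda>w. N (b # w)) (a # u) v"
    by (rule 3(2), rule 3(3)) auto
  ultimately show ?case by simp
qed auto

text \<open>All interleavings of \<open>u\<close> and \<open>v\<close> consist of the same letters,
  so an additive weight is constant on them.\<close>

lemma shuffle_sum_weight:
  fixes g :: "'a list \<Rightarrow> 'b::comm_ring_1"
  assumes g: "\<And>u v. g (u @ v) = g u + g v"
  shows "shuffle_sum (\<lambda>w. g w * M w) u v = (g u + g v) * shuffle_sum M u v"
proof -
  have 0: "g [] = 0" using g[of "[]" "[]"] by simp
  define h where "h = (\<lambda>a. g [a])"
  have c: "g (a # w) = h a + g w" for a w using g[of "[a]" w] by (simp add: h_def)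
  show ?thesis
  proof (induction M u v rule: shuffle_sum.induct)
    case (3 M a u b v)
    have "shuffle_sum (\<lambda>w. g (x # w) * M (x # w)) u' v' =
        h x * shuffle_sum (\<lambda>w. M (x # w)) u' v' + shuffle_sum (\<lambda>w. g w * M (x # w)) u' v'" for x u' v'
      by (simp add: c distrib_right shuffle_sum_add shuffle_sum_scale)
    then show ?case
      by (simp add: 3 c[of a u] c[of b v] algebra_simps)
  qed (simp_all add: 0)
qed

text \<open>The mould product in two word variables, cutting both words at once. With
  \<open>shuffle_sum M\<close> as the coproduct of \<open>M\<close>, symmetrality becomes an
  identity in this algebra.\<close>

definition bmul :: "('a list \<Rightarrow> 'a list \<Rightarrow> 'b::ring_1) \<Rightarrow> ('a list \<Rightarrow> 'a list \<Rightarrow> 'b) \<Rightarrow> 'a list \<Rightarrow> 'a list \<Rightarrow> 'b"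
  where "bmul B B' u v =
    (\<Sum>i\<le>length u. \<Sum>j\<le>length v. B (take i u) (take j v) * B' (drop i u) (drop j v))"

lemma bmul_tensor:
  fixes M :: "'a list \<Rightarrow> 'b::comm_ring_1"
  shows "bmul (\<lambda>u v. M u * N v) (\<lambda>u v. M' u * N' v) u v = cmul M M' u * cmul N N' v"
  by (simp add: bmul_def cmul_def sum_product mult_ac)

lemma bmul_Nil_right: "bmul B B' u [] = cmul (\<lambda>u. B u []) (\<lambda>u. B' u []) u"
  by (simp add: bmul_def cmul_def)

lemma bmul_Nil_left: "bmul B B' [] v = cmul (B []) (B' []) v"
  by (simp add: bmul_def cmul_def)

text \<open>Cutting an interleaving in two is the same as cutting both words and interleaving the
  first parts and the last parts. The induction is on the total length because the recursion
  shortens either word.\<close>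

lemma shuffle_sum_cmul:
  "shuffle_sum (cmul M M') u v = bmul (shuffle_sum M) (shuffle_sum M') u v"
proof (induction "length u + length v" arbitrary: u v M rule: less_induct)
  case less
  show ?case
  proof (cases "u = [] \<or> v = []")
    case False
    then obtain a u' b v' where uv: "u = a # u'" "v = b # v'"
      by (metis neq_Nil_conv)
    let ?s = shuffle_sum
    have eq: "(\<lambda>w. cmul M M' (x # w)) = (\<lambda>w. M [] * M' (x # w) + cmul (\<lambda>u. M (x # u)) M' w)" for x
      by (intro ext) (simp add: cmul_Cons)
    have IH1: "?s (cmul (\<lambda>w. M (a # w)) M') u' v = bmul (?s (\<lambda>w. M (a # w))) (?s M') u' v"
      by (rule less) (simp add: uv)
    have IH2: "?s (cmul (\<lambda>w. M (b # w)) M') u v' = bmul (?s (\<lambda>w. M (b # w))) (?s M') u v'"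
      by (rule less) (simp add: uv)
    \<comment> \<open>Four groups of terms: both prefixes empty, only that of \<open>u\<close>, only
      that of \<open>v\<close>, neither. Facts 2 and 3 collect the terms whose first letter is
      \<open>a\<close> or \<open>b\<close>; the last group is shared out by the recursion of
      \<open>shuffle_sum\<close>.\<close>
    have 1: "bmul (?s M) (?s M') u v = M [] * ?s M' u v
        + (\<Sum>j\<le>length v'. M (b # take j v') * ?s M' u (drop j v'))
        + (\<Sum>i\<le>length u'. M (a # take i u') * ?s M' (drop i u') v)
        + (\<Sum>i\<le>length u'. \<Sum>j\<le>length v'. ?s M (a # take i u') (b # take j v') * ?s M' (drop i u') (drop j v'))"
      by (simp add: uv bmul_def sum.atMost_Suc_shift sum.distrib del: sum.atMost_Suc shuffle_sum.simps(3))
    have 2: "bmul (?s (\<lambda>w. M (a # w))) (?s M') u' v =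
          (\<Sum>i\<le>length u'. M (a # take i u') * ?s M' (drop i u') v)
        + (\<Sum>i\<le>length u'. \<Sum>j\<le>length v'. ?s (\<lambda>w. M (a # w)) (take i u') (b # take j v') * ?s M' (drop i u') (drop j v'))"
      by (simp add: uv bmul_def sum.atMost_Suc_shift sum.distrib del: sum.atMost_Suc shuffle_sum.simps(3))
    have 3: "bmul (?s (\<lambda>w. M (b # w))) (?s M') u v' =
          (\<Sum>j\<le>length v'. M (b # take j v') * ?s M' u (drop j v'))
        + (\<Sum>i\<le>length u'. \<Sum>j\<le>length v'. ?s (\<lambda>w. M (b # w)) (a # take i u') (take j v') * ?s M' (drop i u') (drop j v'))"
      by (simp add: uv bmul_def sum.atMost_Suc_shift sum.distrib del: sum.atMost_Suc shuffle_sum.simps(3))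
    have "?s (cmul M M') u v = M [] * ?s M' u v
        + bmul (?s (\<lambda>w. M (a # w))) (?s M') u' v + bmul (?s (\<lambda>w. M (b # w))) (?s M') u v'"
      by (simp add: uv eq shuffle_sum_add shuffle_sum_scale IH1[unfolded uv] IH2[unfolded uv] distrib_left)
    also have "\<dots> = bmul (?s M) (?s M') u v"
      by (simp add: 1 2 3 sum.distrib distrib_right)
    finally show ?thesis .
  qed (auto simp: bmul_Nil_left bmul_Nil_right shuffle_sum_Nil_left)
qed

section \<open>Birkhoff decomposition\<close>

lemma K_plus_add: "f \<in> K_plus \<Longrightarrow> g \<in> K_plus \<Longrightarrow> f + g \<in> K_plus"
  by (simp add: K_plus_def)

lemma K_plus_minus: "f \<in> K_plus \<Longrightarrow> g \<in> K_plus \<Longrightarrow> f - g \<in> K_plus"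
  by (simp add: K_plus_def)

lemma K_plus_sum: "(\<And>i. i \<in> I \<Longrightarrow> f i \<in> K_plus) \<Longrightarrow> sum f I \<in> K_plus"
  by (induction I rule: infinite_finite_induct) (auto simp: K_plus_add, auto simp: K_plus_def)

lemma K_plus_mult:
  assumes "f \<in> K_plus" "g \<in> K_plus"
  shows "f * g \<in> K_plus"
proof -
  have "(\<Sum>i = fls_subdegree f..n - fls_subdegree g. f $$ i * g $$ (n - i)) = 0" if "n < 0" for n
  proof (rule sum.neutral, rule ballI)
    fix i
    have "i < 0 \<or> n - i < 0" using that by linarith
    then show "f $$ i * g $$ (n - i) = 0" using assms by (auto simp: K_plus_def)
  qed
  then show ?thesis by (simp add: K_plus_def fls_times_nth(2))
qed

lemma K_plus_const [simp]: "fls_const c \<in> K_plus"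
  by (simp add: K_plus_def)

lemma K_plus_X [simp]: "fls_X \<in> K_plus"
  by (simp add: K_plus_def)

lemma K_plus_0 [simp]: "0 \<in> K_plus"
  by (simp add: K_plus_def)

lemma K_plus_1 [simp]: "1 \<in> K_plus"
  by (simp add: K_plus_def)

lemma K_plus_of_nat [simp]: "of_nat n \<in> K_plus"
  by (induction n) (auto intro: K_plus_add)

lemma K_minus_0 [simp]: "0 \<in> K_minus"
  by (simp add: K_minus_def)

lemma K_minus_add: "f \<in> K_minus \<Longrightarrow> g \<in> K_minus \<Longrightarrow> f + g \<in> K_minus"
  by (simp add: K_minus_def)

lemma K_minus_minus: "f \<in> K_minus \<Longrightarrow> g \<in> K_minus \<Longrightarrow> f - g \<in> K_minus"
  by (simp add: K_minus_def)

text \<open>Both factors only have exponents up to \<open>-1\<close>, so the product only has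
  exponents up to \<open>-2\<close>. The case \<open>n = -1\<close>, a vanishing residue, is what
  makes \<open>coeff\<close> alternal.\<close>

lemma K_minus_mult_nth:
  assumes "f \<in> K_minus" "g \<in> K_minus" "n \<ge> -1"
  shows "(f * g) $$ n = 0"
proof -
  have "f $$ i * g $$ (n - i) = 0" for i
  proof -
    have "i \<ge> 0 \<or> n - i \<ge> 0" using assms(3) by linarith
    then show ?thesis using assms(1,2) by (auto simp: K_minus_def)
  qed
  then show ?thesis unfolding fls_times_nth(2) by (intro sum.neutral) blast
qed

lemma K_minus_mult: "f \<in> K_minus \<Longrightarrow> g \<in> K_minus \<Longrightarrow> f * g \<in> K_minus"
  using K_minus_mult_nth[of f g] by (simp add: K_minus_def)

lemma K_plus_K_minus_eq_0: "f \<in> K_plus \<Longrightarrow> f \<in> K_minus \<Longrightarrow> f = 0"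
  by (rule fls_eqI) (metis (mono_tags, lifting) K_minus_def K_plus_def fls_zero_nth linorder_not_le mem_Collect_eq)

lemma fls_X_mult_nth [simp]: "(fls_X * f) $$ n = (f :: 'b::ring_1 fls) $$ (n - 1)"
  by (simp add: fls_X_times_conv_shift)

lemma fls_of_nat_mult_nth [simp]: "(of_nat m * f) $$ n = of_nat m * (f :: 'b::ring_1 fls) $$ n"
  by (simp add: fls_of_nat)

section \<open>The mould T and its symmetrality\<close>

text \<open>The eigenvalue of \<nabla> + \<epsilon> L on a word; for a nonempty word it is the last
  factor in the denominator of \<open>T_mould\<close>.\<close>

definition weight :: "complex list \<Rightarrow> complex fls" where
  "weight w = fls_const (sum_list w) + of_nat (length w) * fls_X"

lemma weight_append: "weight (u @ v) = weight u + weight v"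
  by (simp add: weight_def algebra_simps fls_plus_const)

lemma weight_Nil [simp]: "weight [] = 0"
  by (simp add: weight_def)

lemma weight_nth_1: "weight w $$ 1 = of_nat (length w)"
  by (simp add: weight_def fls_of_nat)

lemma weight_nonzero: "w \<noteq> [] \<Longrightarrow> weight w \<noteq> 0"
  using weight_nth_1[of w] by auto

lemma K_plus_weight: "weight w \<in> K_plus"
  by (simp add: weight_def K_plus_add K_plus_mult)

lemma weight_mult_nth: "(weight w * f) $$ n = sum_list w * f $$ n + of_nat (length w) * f $$ (n - 1)"
  by (simp add: weight_def distrib_right mult.assoc)

lemma T_mould_Nil [simp]: "T_mould [] = 1"
  by (simp add: T_mould_def)

lemma letter_mould_Nil [simp]: "letter_mould [] = 0"
  by (simp add: letter_mould_def)

text \<open>Multiplying by the weight cancels the last factor of the denominator, which leaves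
  \<open>T_mould\<close> of the word without its last letter.\<close>

lemma weight_T_mould: "weight w * T_mould w = cmul T_mould letter_mould w"
proof (cases w rule: rev_cases)
  case (snoc u a)
  have "T_mould w = 1 / (\<Prod>j=1..length w. weight (take j w))"
    unfolding T_mould_def by (intro arg_cong2[where f = "(/)"] prod.cong refl) (auto simp: weight_def)
  also have "(\<Prod>j=1..length w. weight (take j w)) = (\<Prod>j=1..length u. weight (take j w)) * weight w"
    by (simp add: snoc)
  also have "(\<Prod>j=1..length u. weight (take j w)) = (\<Prod>j=1..length u. fls_const (sum_list (take j u)) + of_nat j * fls_X)"
    by (intro prod.cong refl) (auto simp: snoc weight_def)
  finally have "T_mould w = T_mould u / weight w"
    by (simp add: T_mould_def)
  then show ?thesis
    using weight_nonzero[of w] by (simp add: snoc cmul_letter_right)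
qed simp

lemma shuffle_sum_unit: "shuffle_sum unit_mould u v = unit_mould u * unit_mould v"
proof (cases "u = [] \<or> v = []")
  case False
  then obtain a u' b v' where "u = a # u'" "v = b # v'" by (metis neq_Nil_conv)
  then show ?thesis by (simp add: unit_mould_def)
qed (auto simp: unit_mould_def)

lemma shuffle_sum_letter:
  fixes u v :: "'a list"
  shows "shuffle_sum letter_mould u v = (letter_mould u * unit_mould v + unit_mould u * letter_mould v :: 'b::ring_1)"
proof (cases "u = [] \<or> v = []")
  case False
  then obtain a u' b v' where uv: "u = a # u'" "v = b # v'" by (metis neq_Nil_conv)
  have "(\<lambda>w. letter_mould (x # w) :: 'b) = unit_mould" for x :: 'a
    by (auto simp: letter_mould_def unit_mould_def)
  then show ?thesis by (simp add: uv shuffle_sum_unit) (simp add: unit_mould_def)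
qed (auto simp: unit_mould_def letter_mould_def)

text \<open>Both sides solve the same equation: \<open>weight u + weight v\<close> times the unknown
  is its product with the coproduct of \<open>letter_mould\<close>. The right-hand side only
  involves shorter pairs, and the weight is invertible on a nonempty pair.\<close>

lemma shuffle_sum_T_mould: "shuffle_sum T_mould u v = T_mould u * T_mould v"
proof (induction "length u + length v" arbitrary: u v rule: less_induct)
  case less
  let ?I = "\<lambda>u v. letter_mould u * unit_mould v + unit_mould u * letter_mould v :: complex fls"
  show ?case
  proof (cases "u = [] \<or> v = []")
    case False
    have w: "weight u + weight v \<noteq> 0"
      using False weight_nonzero[of "u @ v"] by (simp add: weight_append)
    have "(weight u + weight v) * shuffle_sum T_mould u v = shuffle_sum (cmul T_mould letter_mould) u v"
      using shuffle_sum_weight[of weight T_mould u v] by (simp add: weight_append weight_T_mould)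
    also have "\<dots> = bmul (shuffle_sum T_mould) ?I u v"
      by (simp add: shuffle_sum_cmul bmul_def shuffle_sum_letter)
    also have "\<dots> = bmul (\<lambda>u v. T_mould u * T_mould v) ?I u v"
      unfolding bmul_def
    proof (intro sum.cong refl)
      fix i j
      assume ij: "i \<in> {..length u}" "j \<in> {..length v}"
      show "shuffle_sum T_mould (take i u) (take j v) * ?I (drop i u) (drop j v) =
            T_mould (take i u) * T_mould (take j v) * ?I (drop i u) (drop j v)"
      \<comment> \<open>The full pair is out of reach of the induction hypothesis, but there
        \<open>?I [] [] = 0\<close>.\<close>
      proof (cases "i = length u \<and> j = length v")
        case False
        then have "shuffle_sum T_mould (take i u) (take j v) = T_mould (take i u) * T_mould (take j v)"
          using ij by (intro less) auto
        then show ?thesis by simp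
      qed (simp add: letter_mould_def unit_mould_def)
    qed
    also have "\<dots> = bmul (\<lambda>u v. T_mould u * T_mould v) (\<lambda>u v. letter_mould u * unit_mould v) u v
                  + bmul (\<lambda>u v. T_mould u * T_mould v) (\<lambda>u v. unit_mould u * letter_mould v) u v"
      by (simp add: bmul_def distrib_left sum.distrib)
    also have "\<dots> = (weight u + weight v) * (T_mould u * T_mould v)"
      by (simp only: bmul_tensor cmul_unit_right weight_T_mould[symmetric]) (simp add: algebra_simps)
    finally show ?thesis using w by simp
  qed auto
qed

text \<open>Applied to the difference of two polar parts, this is uniqueness of the Birkhoff decomposition.\<close>

lemma cmul_K_minus_K_plus_eq_0:
  assumes T: "T [] = 1"
    and C: "\<And>w. w \<in> lists A \<Longrightarrow> C w \<in> K_minus"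
    and CT: "\<And>w. w \<in> lists A \<Longrightarrow> cmul C T w \<in> K_plus"
    and w: "w \<in> lists A"
  shows "C w = 0"
  using w
proof (induction "length w" arbitrary: w rule: less_induct)
  case less
  have "C (take i w) = 0" if "i < length w" for i
    using that less(2) by (intro less(1)) (auto simp: in_lists_conv_set dest: in_set_takeD)
  \<comment> \<open>Only the full prefix survives, so \<open>C w\<close> is polar and regular at
    once.\<close>
  then have "cmul C T w = C w"
    by (simp add: cmul_def lessThan_Suc_atMost[symmetric] T)
  then show ?case
    using C CT less(2) K_plus_K_minus_eq_0 by metis
qed

text \<open>The same triangularity argument in two word variables, by induction on the total length;
  it serves to show that a polar part is symmetral.\<close>

lemma bmul_K_minus_K_plus_eq_0:
  assumes T: "T [] [] = 1"
    and C: "\<And>u v. u \<in> lists A \<Longrightarrow> v \<in> lists A \<Longrightarrow> C u v \<in> K_minus"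
    and CT: "\<And>u v. u \<in> lists A \<Longrightarrow> v \<in> lists A \<Longrightarrow> bmul C T u v \<in> K_plus"
    and uv: "u \<in> lists A" "v \<in> lists A"
  shows "C u v = 0"
  using uv
proof (induction "length u + length v" arbitrary: u v rule: less_induct)
  case less
  have 0: "C (take i u) (take j v) = 0" if "i \<le> length u" "j \<le> length v" "i \<noteq> length u \<or> j \<noteq> length v" for i j
    using that less(2,3) by (intro less(1)) (auto simp: in_lists_conv_set dest: in_set_takeD)
  have "bmul C T u v = (\<Sum>i\<le>length u. \<Sum>j\<le>length v. if i = length u then if j = length v then C u v else 0 else 0)"
    unfolding bmul_def
  proof (intro sum.cong refl)
    fix i j assume "i \<in> {..length u}" "j \<in> {..length v}"
    then show "C (take i u) (take j v) * T (drop i u) (drop j v) =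
        (if i = length u then if j = length v then C u v else 0 else 0)"
      using 0[of i j] by (cases "i = length u \<and> j = length v") (auto simp: T)
  qed
  also have "\<dots> = (\<Sum>i\<le>length u. if i = length u then C u v else 0)"
    by (intro sum.cong refl) (simp add: sum.delta)
  finally have "bmul C T u v = C u v" by simp
  then show ?case
    using C CT less(2,3) K_plus_K_minus_eq_0 by metis
qed

text \<open>Interleavings of a nonempty pair are nonempty, so \<open>M []\<close> never enters. This
  matters because \<open>Uminus [] = 1\<close> is not polar.\<close>

lemma shuffle_sum_closed:
  assumes "u \<in> lists A" "v \<in> lists A" "u \<noteq> [] \<or> v \<noteq> []"
    and "\<And>w. w \<in> lists A \<Longrightarrow> w \<noteq> [] \<Longrightarrow> M w \<in> S"
    and "\<And>x y. x \<in> S \<Longrightarrow> y \<in> S \<Longrightarrow> x + y \<in> S"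
  shows "shuffle_sum M u v \<in> S"
  using assms by (induction M u v rule: shuffle_sum.induct) auto

section \<open>Consequences of a Birkhoff decomposition of T\<close>

locale birkhoff =
  fixes Alph :: "complex set" and Uplus Uminus :: mould
  assumes decomp: "is_birkhoff_decomposition Alph T_mould Uplus Uminus"
begin

lemma Uplus_Nil [simp]: "Uplus [] = 1" and Uminus_Nil [simp]: "Uminus [] = 1"
  using decomp by (auto simp: is_birkhoff_decomposition_def)

lemma Uminus_K_minus: "w \<in> lists Alph \<Longrightarrow> w \<noteq> [] \<Longrightarrow> Uminus w \<in> K_minus"
  and Uplus_K_plus: "w \<in> lists Alph \<Longrightarrow> Uplus w \<in> K_plus"
  and cmul_Uminus_T: "w \<in> lists Alph \<Longrightarrow> cmul Uminus T_mould w = Uplus w"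
  using decomp K_plus_1 unfolding is_birkhoff_decomposition_def mould_mult_eq_cmul by metis+

text \<open>The defect of symmetrality of \<open>Uminus\<close> is polar. Multiplied on the right by
  two copies of \<open>T_mould\<close> it becomes the defect of \<open>Uplus\<close>, which is
  regular; hence it vanishes.\<close>

lemma shuffle_sum_Uminus:
  assumes "u \<in> lists Alph" "v \<in> lists Alph"
  shows "shuffle_sum Uminus u v = Uminus u * Uminus v"
proof -
  let ?C = "\<lambda>u v. shuffle_sum Uminus u v - Uminus u * Uminus v"
  let ?T = "\<lambda>u v. T_mould u * T_mould v"
  have "?C u v = 0"
  proof (rule bmul_K_minus_K_plus_eq_0[of ?T Alph ?C])
    fix u v assume uv: "u \<in> lists Alph" "v \<in> lists Alph"
    show "?C u v \<in> K_minus"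
    proof (cases "u = [] \<or> v = []")
      case False
      then show ?thesis
        using uv by (intro K_minus_minus K_minus_mult Uminus_K_minus shuffle_sum_closed[of _ Alph] K_minus_add) auto
    qed auto
    have "bmul ?C ?T u v = bmul (shuffle_sum Uminus) (shuffle_sum T_mould) u v - bmul (\<lambda>u v. Uminus u * Uminus v) ?T u v"
      by (simp add: bmul_def left_diff_distrib sum_subtractf shuffle_sum_T_mould)
    also have "\<dots> = shuffle_sum (cmul Uminus T_mould) u v - Uplus u * Uplus v"
      using uv by (simp add: bmul_tensor cmul_Uminus_T shuffle_sum_cmul)
    also have "shuffle_sum (cmul Uminus T_mould) u v = shuffle_sum Uplus u v"
      using uv by (intro shuffle_sum_cong cmul_Uminus_T) auto
    also have "shuffle_sum Uplus u v - Uplus u * Uplus v \<in> K_plus"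
      using uv by (cases "u = [] \<and> v = []")
        (auto intro!: K_plus_minus K_plus_mult Uplus_K_plus shuffle_sum_closed[of _ Alph] K_plus_add)
    finally show "bmul ?C ?T u v \<in> K_plus" .
  qed (use assms in auto)
  then show ?thesis by simp
qed

definition coeff :: "complex list \<Rightarrow> complex" where
  "coeff w = - fls_residue (Uminus w)"

lemma shuffle_sum_coeff:
  assumes "u \<in> lists Alph" "v \<in> lists Alph" "u \<noteq> []" "v \<noteq> []"
  shows "shuffle_sum coeff u v = 0"
proof -
  have "shuffle_sum (\<lambda>w. - fls_residue (Uminus w)) u v = - fls_residue (shuffle_sum Uminus u v)"
    by (rule shuffle_sum_hom) simp_all
  also have "\<dots> = 0"
    using assms by (simp add: shuffle_sum_Uminus K_minus_mult_nth Uminus_K_minus)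
  finally show ?thesis by (simp add: coeff_def[abs_def])
qed

text \<open>The mould \<Phi>: coefficients of plain words, while \<open>coeff\<close> gives those of
  nested commutators. The length factor is the one in the Dynkin identity.\<close>

definition nf_mould :: "complex list \<Rightarrow> complex" where
  "nf_mould w = of_nat (length w) * coeff w"

text \<open>The mould G, whose operator series conjugates the perturbed operator to its normal
  form.\<close>

definition gauge_mould :: "complex list \<Rightarrow> complex" where
  "gauge_mould w = Uplus w $$ 0"

lemma gauge_mould_Nil [simp]: "gauge_mould [] = 1"
  by (simp add: gauge_mould_def)

lemma nf_mould_Nil [simp]: "nf_mould [] = 0"
  by (simp add: nf_mould_def)

text \<open>The Leibniz rule moves the weight from \<open>Uminus\<close> to \<open>Uplus\<close> and
  \<open>T_mould\<close>, and the equation of \<open>T_mould\<close> turns the latter term into a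
  product with \<open>letter_mould\<close>.\<close>

lemma cmul_weight_Uminus_T:
  assumes w: "w \<in> lists Alph"
  shows "cmul (\<lambda>w. weight w * Uminus w + cmul M Uminus w) T_mould w
       = weight w * Uplus w - cmul Uplus letter_mould w + cmul M Uplus w"
proof -
  have "cmul (\<lambda>w. weight w * Uminus w + cmul M Uminus w) T_mould w
      = cmul (\<lambda>w. weight w * Uminus w) T_mould w + cmul (cmul M Uminus) T_mould w"
    by (rule cmul_add_left)
  also have "cmul (\<lambda>w. weight w * Uminus w) T_mould w
      = weight w * cmul Uminus T_mould w - cmul Uminus (cmul T_mould letter_mould) w"
    using cmul_derivation[of weight w Uminus T_mould] by (simp add: weight_append weight_T_mould)
  also have "cmul Uminus (cmul T_mould letter_mould) w = cmul (cmul Uminus T_mould) letter_mould w"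
    by (rule cmul_assoc[symmetric])
  also have "\<dots> = cmul Uplus letter_mould w"
    by (rule cmul_cong_lists[OF _ _ w]) (simp_all add: cmul_Uminus_T)
  also have "cmul (cmul M Uminus) T_mould w = cmul M (cmul Uminus T_mould) w"
    by (rule cmul_assoc)
  also have "\<dots> = cmul M Uplus w"
    by (rule cmul_cong_lists[OF _ _ w]) (simp_all add: cmul_Uminus_T)
  finally show ?thesis using w by (simp add: cmul_Uminus_T)
qed

text \<open>
  The left-hand side is polar, and its product with \<open>T\<close> is regular.
\<close>

lemma weight_Uminus:
  assumes "w \<in> lists Alph"
  shows "weight w * Uminus w + cmul (\<lambda>u. fls_const (nf_mould u)) Uminus w = 0"
proof (rule cmul_K_minus_K_plus_eq_0[of T_mould Alph, OF _ _ _ assms])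
  fix w assume w: "w \<in> lists Alph"
  have "(weight w * Uminus w + cmul (\<lambda>u. fls_const (nf_mould u)) Uminus w) $$ n = 0" if n: "n \<ge> 0" for n
  proof (cases "w = []")
    case False
    have "cmul (\<lambda>u. fls_const (nf_mould u)) Uminus w $$ n =
        (\<Sum>i\<le>length w. nf_mould (take i w) * Uminus (drop i w) $$ n)"
      by (simp add: cmul_def fls_nth_sum)
    \<comment> \<open>At orders \<open>n \<ge> 0\<close> every polar factor drops out; only
      \<open>Uminus [] = 1\<close> remains.\<close>
    also have "\<dots> = (\<Sum>i\<le>length w. if i = length w then nf_mould w * (if n = 0 then 1 else 0) else 0)"
    proof (intro sum.cong refl)
      fix i assume "i \<in> {..length w}"
      moreover have "Uminus (drop i w) \<in> K_minus" if "i < length w"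
        using that w by (intro Uminus_K_minus) (auto simp: in_lists_conv_set dest: in_set_dropD)
      ultimately show "nf_mould (take i w) * Uminus (drop i w) $$ n =
          (if i = length w then nf_mould w * (if n = 0 then 1 else 0) else 0)"
        using n by (auto simp: K_minus_def)
    qed
    finally have 1: "cmul (\<lambda>u. fls_const (nf_mould u)) Uminus w $$ n = nf_mould w * (if n = 0 then 1 else 0)"
      by simp
    have "Uminus w \<in> K_minus" using w False by (rule Uminus_K_minus)
    \<comment> \<open>At order 0 the weight contributes the length times the residue of
      \<open>Uminus w\<close>, which is exactly what \<open>nf_mould w\<close> cancels.\<close>
    then show ?thesis
      using n unfolding fls_plus_nth 1 weight_mult_nth
      by (cases "n = 0") (auto simp: K_minus_def nf_mould_def coeff_def)
  qed simp
  then show "weight w * Uminus w + cmul (\<lambda>u. fls_const (nf_mould u)) Uminus w \<in> K_minus"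
    by (simp add: K_minus_def)
  show "cmul (\<lambda>w. weight w * Uminus w + cmul (\<lambda>u. fls_const (nf_mould u)) Uminus w) T_mould w \<in> K_plus"
    unfolding cmul_weight_Uminus_T[OF w] cmul_def[of _ Uplus]
    using w by (auto simp: cmul_letter_right in_lists_conv_set
        dest: in_set_dropD in_set_butlastD
        intro!: K_plus_add K_plus_minus K_plus_mult K_plus_weight Uplus_K_plus K_plus_sum)
qed simp

text \<open>Multiplying \<open>weight_Uminus\<close> by \<open>T_mould\<close> gives an equation for
  \<open>Uplus\<close>; this is its coefficient of order 0. The length part of the weight drops out
  because \<open>Uplus\<close> has no polar terms.\<close>

lemma gauge_mould_equation:
  assumes "w \<in> lists Alph"
  shows "sum_list w * gauge_mould w = cmul gauge_mould letter_mould w - cmul nf_mould gauge_mould w"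
proof -
  let ?N = "\<lambda>u. fls_const (nf_mould u)"
  have "cmul (\<lambda>w. weight w * Uminus w + cmul ?N Uminus w) T_mould w = cmul (\<lambda>w. 0) T_mould w"
    by (rule cmul_cong_lists[OF _ _ assms]) (simp_all add: weight_Uminus)
  then have "weight w * Uplus w - cmul Uplus letter_mould w + cmul ?N Uplus w = 0"
    unfolding cmul_weight_Uminus_T[OF assms] by (simp add: cmul_def[of "\<lambda>w. 0"])
  then have "(weight w * Uplus w) $$ 0 - cmul Uplus letter_mould w $$ 0 + cmul ?N Uplus w $$ 0 = 0"
    by (metis fls_minus_nth fls_plus_nth fls_zero_nth)
  moreover have "(weight w * Uplus w) $$ 0 = sum_list w * gauge_mould w"
    using Uplus_K_plus[OF assms] by (simp add: weight_mult_nth K_plus_def gauge_mould_def)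
  moreover have "cmul Uplus letter_mould w $$ 0 = cmul gauge_mould letter_mould w"
    by (simp add: cmul_letter_right gauge_mould_def)
  moreover have "cmul ?N Uplus w $$ 0 = cmul nf_mould gauge_mould w"
    by (simp add: cmul_def fls_nth_sum gauge_mould_def)
  ultimately show ?thesis by (simp add: algebra_simps)
qed

text \<open>Every splitting of a word with nonzero sum has a piece with nonzero sum. By induction
  the equation for \<open>Uminus\<close> thus reduces, at negative orders, to a two-term recursion
  between consecutive coefficients, which fails at the lowest one.\<close>

lemma resonant_support:
  assumes "w \<in> lists Alph" "sum_list w \<noteq> 0"
  shows "Uminus w = 0"
  using assms
proof (induction "length w" arbitrary: w rule: less_induct)
  case less
  have ne: "w \<noteq> []" using less(3) by auto
  have "nf_mould (take i w) * Uminus (drop i w) $$ n = 0" if i: "i < length w" for i n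
  \<comment> \<open>For \<open>i = 0\<close> the right piece is \<open>w\<close> itself, but then
    \<open>nf_mould [] = 0\<close>.\<close>
  proof (cases "i = 0")
    case False
    have "sum_list (take i w) \<noteq> 0 \<or> sum_list (drop i w) \<noteq> 0"
      using less(3) by (metis append_take_drop_id sum_list_append add_0)
    then have "Uminus (take i w) = 0 \<or> Uminus (drop i w) = 0"
    proof
      assume "sum_list (take i w) \<noteq> 0"
      then have "Uminus (take i w) = 0"
        using less(2) i by (intro less(1)) (auto simp: in_lists_conv_set dest: in_set_takeD)
      then show ?thesis ..
    next
      assume "sum_list (drop i w) \<noteq> 0"
      then have "Uminus (drop i w) = 0"
        using less(2) i False by (intro less(1)) (auto simp: in_lists_conv_set dest: in_set_dropD)
      then show ?thesis ..
    qed
    then show ?thesis by (auto simp: nf_mould_def coeff_def)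
  qed simp
  then have "(\<Sum>i<length w. nf_mould (take i w) * Uminus (drop i w) $$ n) = 0" for n
    by (intro sum.neutral) simp
  then have "cmul (\<lambda>u. fls_const (nf_mould u)) Uminus w $$ n = nf_mould w * (if n = 0 then 1 else 0)" for n
    by (simp add: cmul_def fls_nth_sum lessThan_Suc_atMost[symmetric])
  then have eq: "sum_list w * Uminus w $$ n + of_nat (length w) * Uminus w $$ (n - 1) = 0" if "n < 0" for n
    using that arg_cong[OF weight_Uminus[OF less(2)], of "\<lambda>f. f $$ n"]
    by (simp only: fls_plus_nth weight_mult_nth) simp
  have km: "Uminus w \<in> K_minus" using less(2) ne by (rule Uminus_K_minus)
  show ?case
  proof (rule ccontr)
    assume nz: "Uminus w \<noteq> 0"
    \<comment> \<open>At the lowest exponent the recursion leaves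
      \<open>sum_list w * Uminus w $$ d = 0\<close>.\<close>
    define d where "d = fls_subdegree (Uminus w)"
    have d: "Uminus w $$ d \<noteq> 0" "Uminus w $$ (d - 1) = 0"
      using nz by (auto simp: d_def)
    have "d < 0" using d(1) km by (simp add: K_minus_def) (metis linorder_not_le)
    then show False using eq[of d] d less(3) by simp
  qed
qed

lemma nf_mould_resonant: "w \<in> lists Alph \<Longrightarrow> sum_list w \<noteq> 0 \<Longrightarrow> nf_mould w = 0"
  by (simp add: nf_mould_def coeff_def resonant_support)

end

unbundle no vec_syntax

section \<open>Words in a ring\<close>

definition words :: "'a set \<Rightarrow> nat \<Rightarrow> 'a list set" where
  "words A k = {w \<in> lists A. length w = k}"

definition word_pairs :: "'a set \<Rightarrow> nat \<Rightarrow> ('a list \<times> 'a list) set" where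
  "word_pairs A k = {(u, v). u \<in> lists A \<and> v \<in> lists A \<and> length u + length v = k}"

lemma finite_words [simp]: "finite A \<Longrightarrow> finite (words A k)"
  using finite_lists_length_eq[of A k] by (simp add: words_def lists_eq_set)

lemma words_0 [simp]: "words A 0 = {[]}"
  by (auto simp: words_def)

lemma finite_word_pairs [simp]: "finite A \<Longrightarrow> finite (word_pairs A k)"
proof (rule finite_subset)
  show "word_pairs A k \<subseteq> (\<Union>i\<le>k. words A i) \<times> (\<Union>i\<le>k. words A i)"
    by (auto simp: word_pairs_def words_def)
qed auto

lemma word_pairs_0 [simp]: "word_pairs A 0 = {([], [])}"
  by (auto simp: word_pairs_def)

lemma sum_words_Suc: "(\<Sum>w\<in>words A (Suc k). f w) = (\<Sum>a\<in>A. \<Sum>w\<in>words A k. f (a # w))"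
proof -
  have "bij_betw (\<lambda>(a, w). a # w) (A \<times> words A k) (words A (Suc k))"
    by (rule bij_betwI[where g = "\<lambda>w. (hd w, tl w)"]) (auto simp: words_def length_Suc_conv)
  from sum.reindex_bij_betw[OF this, of f]
  show ?thesis by (simp add: sum.cartesian_product case_prod_unfold)
qed

lemma sum_words_split:
  "(\<Sum>w\<in>words A (i + j). f (take i w) (drop i w)) = (\<Sum>u\<in>words A i. \<Sum>v\<in>words A j. f u v)"
proof -
  have "bij_betw (\<lambda>w. (take i w, drop i w)) (words A (i + j)) (words A i \<times> words A j)"
    by (rule bij_betwI[where g = "\<lambda>(u, v). u @ v"])
       (auto simp: words_def in_lists_conv_set dest: in_set_takeD in_set_dropD)
  from sum.reindex_bij_betw[OF this, of "\<lambda>(u, v). f u v"]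
  show ?thesis by (simp add: sum.cartesian_product)
qed

text \<open>Removing the first letter of a nonempty first word is a bijection; the default 0 for an
  empty first word lets the sum run over all pairs.\<close>

lemma sum_word_pairs_left:
  assumes "finite A"
  shows "(\<Sum>(u, v)\<in>word_pairs A (Suc k). case u of [] \<Rightarrow> 0 | a # u' \<Rightarrow> f a u' v) =
    (\<Sum>a\<in>A. \<Sum>(u, v)\<in>word_pairs A k. f a u v)"
proof -
  let ?h = "\<lambda>(a, u, v). (a # u, v)"
  have "inj_on ?h (A \<times> word_pairs A k)" by (auto simp: inj_on_def)
  moreover have "?h ` (A \<times> word_pairs A k) = {p \<in> word_pairs A (Suc k). fst p \<noteq> []}"
    (is "?L = ?R")
  proof
    show "?R \<subseteq> ?L"
    proof
      fix p assume p: "p \<in> ?R"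
      then obtain a u v where "p = (a # u, v)" by (cases p) (auto simp: neq_Nil_conv)
      with p show "p \<in> ?L" by (intro image_eqI[of _ _ "(a, u, v)"]) (auto simp: word_pairs_def)
    qed
  qed (auto simp: word_pairs_def)
  ultimately have "(\<Sum>p\<in>{p \<in> word_pairs A (Suc k). fst p \<noteq> []}. g p) = (\<Sum>q\<in>A \<times> word_pairs A k. g (?h q))" for g :: "_ \<Rightarrow> 'b"
    using sum.reindex[of ?h "A \<times> word_pairs A k" g] by (simp add: comp_def)
  from this[of "\<lambda>(u, v). case u of [] \<Rightarrow> 0 | a # u' \<Rightarrow> f a u' v"]
  have "(\<Sum>p\<in>{p \<in> word_pairs A (Suc k). fst p \<noteq> []}. case p of (u, v) \<Rightarrow> case u of [] \<Rightarrow> 0 | a # u' \<Rightarrow> f a u' v) =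
    (\<Sum>a\<in>A. \<Sum>(u, v)\<in>word_pairs A k. f a u v)"
    by (simp add: sum.cartesian_product case_prod_unfold)
  moreover have "(\<Sum>p\<in>{p \<in> word_pairs A (Suc k). fst p \<noteq> []}. case p of (u, v) \<Rightarrow> case u of [] \<Rightarrow> 0 | a # u' \<Rightarrow> f a u' v)
     = (\<Sum>(u, v)\<in>word_pairs A (Suc k). case u of [] \<Rightarrow> 0 | a # u' \<Rightarrow> f a u' v)"
    using assms by (intro sum.mono_neutral_left) auto
  ultimately show ?thesis by simp
qed

lemma sum_word_pairs_swap: "(\<Sum>(u, v)\<in>word_pairs A k. f u v) = (\<Sum>(u, v)\<in>word_pairs A k. f v u)"
proof -
  have "bij_betw prod.swap (word_pairs A k) (word_pairs A k)"
    by (rule bij_betwI[where g = prod.swap]) (auto simp: word_pairs_def)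
  from sum.reindex_bij_betw[OF this, of "\<lambda>(u, v). f u v"]
  show ?thesis by (simp add: case_prod_unfold)
qed

lemma sum_word_pairs_right:
  assumes "finite A"
  shows "(\<Sum>(u, v)\<in>word_pairs A (Suc k). case v of [] \<Rightarrow> 0 | b # v' \<Rightarrow> f b u v') =
    (\<Sum>b\<in>A. \<Sum>(u, v)\<in>word_pairs A k. f b u v)"
  using sum_word_pairs_left[OF assms, where f = "\<lambda>b v u. f b u v" and k = k]
  by (subst (1 2) sum_word_pairs_swap) simp

section \<open>Deshuffling and the Dynkin-Specht-Wever identity\<close>

text \<open>The sum over all ways to distribute the letters of a word, in order, to two subwords;
  this is the transpose of \<open>shuffle_sum\<close>.\<close>

fun deshuffle_sum :: "('a list \<Rightarrow> 'a list \<Rightarrow> 'r::ring_1) \<Rightarrow> 'a list \<Rightarrow> 'r" where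
  "deshuffle_sum f [] = f [] []"
| "deshuffle_sum f (a # w) =
     deshuffle_sum (\<lambda>u v. f (a # u) v) w + deshuffle_sum (\<lambda>u v. f u (a # v)) w"

lemma deshuffle_sum_add: "deshuffle_sum (\<lambda>u v. f u v + g u v) w = deshuffle_sum f w + deshuffle_sum g w"
  by (induction w arbitrary: f g) (simp_all add: add_ac)

lemma deshuffle_sum_hom:
  assumes "\<And>x y. h (x + y) = h x + h y"
  shows "deshuffle_sum (\<lambda>u v. h (f u v)) w = h (deshuffle_sum f w)"
  by (induction w arbitrary: f) (simp_all add: assms)

lemma shuffle_sum_cases:
  assumes "(u, v) \<noteq> ([], [])"
  shows "shuffle_sum c u v =
    (case u of [] \<Rightarrow> 0 | a # u' \<Rightarrow> shuffle_sum (\<lambda>w. c (a # w)) u' v) +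
    (case v of [] \<Rightarrow> 0 | b # v' \<Rightarrow> shuffle_sum (\<lambda>w. c (b # w)) u v')"
  using assms by (cases u; cases v) auto

text \<open>A word with a distribution of its letters to two subwords is the same as two words with
  an interleaving.\<close>

lemma sum_words_deshuffle:
  assumes A: "finite A"
  shows "(\<Sum>w\<in>words A k. c w * deshuffle_sum f w) =
         (\<Sum>(u, v)\<in>word_pairs A k. shuffle_sum c u v * f u v)"
proof (induction k arbitrary: c f)
  case (Suc k)
  have "(\<Sum>w\<in>words A (Suc k). c w * deshuffle_sum f w) =
      (\<Sum>a\<in>A. \<Sum>(u, v)\<in>word_pairs A k. shuffle_sum (\<lambda>w. c (a # w)) u v * f (a # u) v) +
      (\<Sum>a\<in>A. \<Sum>(u, v)\<in>word_pairs A k. shuffle_sum (\<lambda>w. c (a # w)) u v * f u (a # v))"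
    by (simp add: sum_words_Suc distrib_left sum.distrib Suc)
  also have "\<dots> = (\<Sum>(u, v)\<in>word_pairs A (Suc k). case u of [] \<Rightarrow> 0 | a # u' \<Rightarrow> shuffle_sum (\<lambda>w. c (a # w)) u' v * f (a # u') v) +
      (\<Sum>(u, v)\<in>word_pairs A (Suc k). case v of [] \<Rightarrow> 0 | b # v' \<Rightarrow> shuffle_sum (\<lambda>w. c (b # w)) u v' * f u (b # v'))"
    by (simp only: sum_word_pairs_left[OF A] sum_word_pairs_right[OF A])
  also have "\<dots> = (\<Sum>(u, v)\<in>word_pairs A (Suc k). shuffle_sum c u v * f u v)"
    unfolding sum.distrib[symmetric]
  proof (intro sum.cong refl, clarify)
    fix u v assume "(u, v) \<in> word_pairs A (Suc k)"
    then have "(u, v) \<noteq> ([], [])" by (auto simp: word_pairs_def)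
    then show "(case u of [] \<Rightarrow> 0 | a # u' \<Rightarrow> shuffle_sum (\<lambda>w. c (a # w)) u' v * f (a # u') v) +
      (case v of [] \<Rightarrow> 0 | b # v' \<Rightarrow> shuffle_sum (\<lambda>w. c (b # w)) u v' * f u (b # v'))
      = shuffle_sum c u v * f u v"
      unfolding shuffle_sum_cases[of u v c, simplified] by (cases u; cases v) (auto simp: distrib_right)
  qed
  finally show ?case .
qed simp

definition word_prod :: "('a \<Rightarrow> 'r::ring_1) \<Rightarrow> 'a list \<Rightarrow> 'r" where
  "word_prod x w = prod_list (map x w)"

lemma word_prod_simps [simp]:
  "word_prod x [] = 1" "word_prod x (a # w) = x a * word_prod x w"
  "word_prod x (u @ v) = word_prod x u * word_prod x v"
  by (simp_all add: word_prod_def)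

fun nested_bracket :: "('a \<Rightarrow> 'r::ring_1) \<Rightarrow> 'a list \<Rightarrow> 'r" where
  "nested_bracket x [] = 0"
| "nested_bracket x [a] = x a"
| "nested_bracket x (a # b # w) =
     x a * nested_bracket x (b # w) - nested_bracket x (b # w) * x a"

text \<open>The antipode of the free associative algebra, evaluated in the ring.\<close>

definition antipode :: "('a \<Rightarrow> 'r::ring_1) \<Rightarrow> 'a list \<Rightarrow> 'r" where
  "antipode x w = (- 1) ^ length w * word_prod x (rev w)"

lemma antipode_simps [simp]: "antipode x [] = 1" "antipode x (a # w) = - (antipode x w * x a)"
  by (simp_all add: antipode_def mult.assoc)

text \<open>The antipode axiom. The first letter ends up leftmost or, with a minus sign, rightmost
  of a sum that is 0 or 1 by induction, so the two contributions cancel.\<close>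

lemma deshuffle_sum_antipode:
  "deshuffle_sum (\<lambda>u v. word_prod x u * antipode x v) w = (if w = [] then 1 else 0)"
proof (induction w)
  case (Cons a w)
  let ?g = "\<lambda>u v. word_prod x u * antipode x v"
  have "deshuffle_sum (\<lambda>u v. x a * ?g u v) w = x a * deshuffle_sum ?g w"
    by (rule deshuffle_sum_hom) (simp add: distrib_left)
  moreover have "deshuffle_sum (\<lambda>u v. - (?g u v * x a)) w = - (deshuffle_sum ?g w * x a)"
    by (rule deshuffle_sum_hom) (simp add: distrib_right)
  ultimately show ?case by (simp add: Cons mult.assoc)
qed simp

text \<open>Right-nested brackets are the convolution of the length-weighted identity with the antipode.\<close>

lemma nested_bracket_deshuffle:
  "nested_bracket x w = deshuffle_sum (\<lambda>u v. of_nat (length u) * (word_prod x u * antipode x v)) w"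
proof (induction w)
  case (Cons a w)
  let ?g = "\<lambda>u v. word_prod x u * antipode x v"
  let ?l = "\<lambda>u v. of_nat (length u) * ?g u v"
  have c: "of_nat n * (x a * y) = x a * (of_nat n * y)" for n y
    by (metis mult.assoc mult_of_nat_commute)
  have "deshuffle_sum (\<lambda>u v. x a * ?g u v) w = x a * deshuffle_sum ?g w"
    and "deshuffle_sum (\<lambda>u v. x a * ?l u v) w = x a * deshuffle_sum ?l w"
    by (rule deshuffle_sum_hom, simp add: distrib_left)+
  moreover have "deshuffle_sum (\<lambda>u v. - (?l u v * x a)) w = - (deshuffle_sum ?l w * x a)"
    by (rule deshuffle_sum_hom) (simp add: distrib_right)
  ultimately have "deshuffle_sum ?l (a # w) = x a * deshuffle_sum ?g w +
      (x a * deshuffle_sum ?l w - deshuffle_sum ?l w * x a)"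
    by (simp add: mult.assoc distrib_right deshuffle_sum_add c add_ac)
  \<comment> \<open>The surplus \<open>x a * deshuffle_sum ?g w\<close> equals \<open>x a\<close>
    for \<open>w = []\<close> and 0 otherwise, which matches the clauses of
    \<open>nested_bracket\<close>.\<close>
  then show ?case
    unfolding Cons[symmetric] deshuffle_sum_antipode by (cases w) auto
qed simp

text \<open>After dualizing, alternality kills the pairs of two nonempty words and the factor
  \<open>length u\<close> kills those with \<open>u = []\<close>; the pairs with
  \<open>v = []\<close> give the right-hand side.\<close>

lemma dynkin_specht_wever:
  assumes A: "finite A"
    and alternal: "\<And>u v. u \<in> lists A \<Longrightarrow> v \<in> lists A \<Longrightarrow> u \<noteq> [] \<Longrightarrow> v \<noteq> [] \<Longrightarrow> shuffle_sum c u v = 0"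
  shows "(\<Sum>w\<in>words A k. c w * nested_bracket x w) = (\<Sum>w\<in>words A k. c w * (of_nat k * word_prod x w))"
proof -
  let ?f = "\<lambda>u v. shuffle_sum c u v * (of_nat (length u) * (word_prod x u * antipode x v))"
  have "(\<Sum>w\<in>words A k. c w * nested_bracket x w) = (\<Sum>(u, v)\<in>word_pairs A k. ?f u v)"
    by (simp add: nested_bracket_deshuffle sum_words_deshuffle[OF A])
  also have "\<dots> = (\<Sum>(u, v)\<in>(\<lambda>w. (w, [])) ` words A k. ?f u v)"
  proof (rule sum.mono_neutral_right)
    show "\<forall>p\<in>word_pairs A k - (\<lambda>w. (w, [])) ` words A k. (case p of (u, v) \<Rightarrow> ?f u v) = 0"
    proof clarify
      fix u v assume uv: "(u, v) \<in> word_pairs A k" "(u, v) \<notin> (\<lambda>w. (w, [])) ` words A k"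
      then have "v \<noteq> []" by (auto simp: word_pairs_def words_def)
      then show "?f u v = 0"
        using alternal[of u v] uv(1) by (cases "u = []") (auto simp: word_pairs_def)
    qed
  next
    show "(\<lambda>w. (w, [])) ` words A k \<subseteq> word_pairs A k" by (auto simp: word_pairs_def words_def)
  qed (use A in simp)
  also have "\<dots> = (\<Sum>w\<in>words A k. c w * (of_nat k * word_prod x w))"
    by (subst sum.reindex) (auto simp: inj_on_def words_def intro!: sum.cong)
  finally show ?thesis .
qed

lemma central_left_commute:
  fixes s :: "'r::ring_1"
  assumes "\<And>y. s * y = y * s"
  shows "y * (s * z) = s * (y * z)"
  using assms[of y] by (simp add: mult.assoc[symmetric])

section \<open>Substituting ring elements for the letters\<close>

text \<open>The contraction of a mould with products of letters; the formal variable counts letters,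
  hence powers of the perturbation.\<close>

definition comould_series :: "'a set \<Rightarrow> ('a \<Rightarrow> 'r::ring_1) \<Rightarrow> ('a list \<Rightarrow> 'r) \<Rightarrow> 'r fps" where
  "comould_series A x c = Abs_fps (\<lambda>k. \<Sum>w\<in>words A k. c w * word_prod x w)"

lemma comould_series_nth: "comould_series A x c $ k = (\<Sum>w\<in>words A k. c w * word_prod x w)"
  by (simp add: comould_series_def)

text \<open>The central coefficients of the right factor can be moved past the product of the left
  piece of a word, so mould products become products of series.\<close>

lemma comould_series_cmul:
  assumes d: "\<And>w y. d w * y = y * d w"
  shows "comould_series A x (cmul c d) = comould_series A x c * comould_series A x d"
proof (rule fps_ext)
  fix n
  have m: "c u * d v * word_prod x (u @ v) = c u * word_prod x u * (d v * word_prod x v)" for u v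
    by (simp add: mult.assoc central_left_commute[OF d])
  have "comould_series A x (cmul c d) $ n =
      (\<Sum>w\<in>words A n. \<Sum>i\<le>n. c (take i w) * d (drop i w) * word_prod x (take i w @ drop i w))"
    unfolding comould_series_nth
    by (intro sum.cong refl) (simp add: cmul_def words_def sum_distrib_right)
  also have "\<dots> = (\<Sum>i\<le>n. \<Sum>w\<in>words A (i + (n - i)). c (take i w) * d (drop i w) * word_prod x (take i w @ drop i w))"
    by (subst sum.swap) simp
  also have "\<dots> = (\<Sum>i\<le>n. \<Sum>u\<in>words A i. \<Sum>v\<in>words A (n - i). c u * d v * word_prod x (u @ v))"
    by (simp only: sum_words_split[where f = "\<lambda>u v. c u * d v * word_prod x (u @ v)"])
  also have "\<dots> = (comould_series A x c * comould_series A x d) $ n"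
    unfolding m fps_mult_nth comould_series_nth sum_product atLeast0AtMost ..
  finally show "comould_series A x (cmul c d) $ n = (comould_series A x c * comould_series A x d) $ n" .
qed

text \<open>The commutator with \<open>h\<close> is a derivation having each letter as an
  eigenvector, so the eigenvalues add up along a word.\<close>

lemma word_prod_eigen:
  assumes x: "\<And>a. a \<in> set w \<Longrightarrow> h * x a = x a * h + s a * x a"
    and s: "\<And>a y. s a * y = y * s a"
  shows "h * word_prod x w = word_prod x w * h + sum_list (map s w) * word_prod x w"
  using x
proof (induction w)
  case (Cons a w)
  have "h * word_prod x (a # w) = (h * x a) * word_prod x w"
    by (simp add: mult.assoc)
  also have "\<dots> = (x a * h + s a * x a) * word_prod x w"
    by (simp add: Cons)
  also have "\<dots> = x a * (h * word_prod x w) + s a * x a * word_prod x w"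
    by (simp add: distrib_right mult.assoc)
  also have "h * word_prod x w = word_prod x w * h + sum_list (map s w) * word_prod x w"
    by (rule Cons) (simp add: Cons)
  also have "x a * (word_prod x w * h + sum_list (map s w) * word_prod x w) =
     x a * word_prod x w * h + sum_list (map s w) * (x a * word_prod x w)"
  proof -
    have "y * sum_list (map s w) = sum_list (map s w) * y" for y
      by (induction w) (simp_all add: s distrib_left distrib_right)
    from central_left_commute[of "sum_list (map s w)", OF this[symmetric]] show ?thesis
      by (simp add: distrib_left mult.assoc)
  qed
  finally show ?case by (simp add: distrib_right mult.assoc add_ac)
qed simp

section \<open>Formal exponentials over a noncommutative ring\<close>

lemma fps_power_nth_eq_0:
  fixes F :: "'r::ring_1 fps"
  assumes "F $ 0 = 0" "n < j"
  shows "(F ^ j) $ n = 0"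
  using assms(2)
proof (induction j arbitrary: n)
  case (Suc j)
  have "F $ i * (F ^ j) $ (n - i) = 0" if "i \<le> n" for i
    using Suc that assms(1) by (cases "i = 0") auto
  then show ?case by (simp add: fps_mult_nth)
qed simp

lemma sum_alternating_inverse_fact:
  "(\<Sum>i\<le>s. (1 / fact i) * ((- 1) ^ (s - i) / fact (s - i)) :: complex) = (if s = 0 then 1 else 0)"
proof -
  have "(\<Sum>i\<le>s. (1 / fact i) * ((- 1) ^ (s - i) / fact (s - i)) :: complex) =
     (\<Sum>i\<le>s. of_nat (s choose i) * 1 ^ i * (- 1) ^ (s - i)) / fact s"
    unfolding sum_divide_distrib by (intro sum.cong refl) (simp add: binomial_fact)
  also have "\<dots> = (1 + (- 1)) ^ s / fact s"
    by (simp only: binomial_ring)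
  also have "\<dots> = (if s = 0 then 1 else 0)" by simp
  finally show ?thesis .
qed

locale central_scalars =
  fixes \<iota> :: "complex \<Rightarrow> 'r::ring_1"
  assumes \<iota>_add: "\<iota> (a + b) = \<iota> a + \<iota> b"
    and \<iota>_mult: "\<iota> (a * b) = \<iota> a * \<iota> b"
    and \<iota>_1 [simp]: "\<iota> 1 = 1"
    and \<iota>_central: "\<iota> a * y = y * \<iota> a"
begin

lemma \<iota>_0 [simp]: "\<iota> 0 = 0"
  using \<iota>_add[of 0 0] by simp

lemma \<iota>_minus: "\<iota> (- a) = - \<iota> a"
  using \<iota>_add[of "- a" a] by (simp add: eq_neg_iff_add_eq_0)

lemma \<iota>_diff: "\<iota> (a - b) = \<iota> a - \<iota> b"
  using \<iota>_add[of a "- b"] by (simp add: \<iota>_minus)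

lemma \<iota>_sum: "\<iota> (sum f I) = (\<Sum>i\<in>I. \<iota> (f i))"
  by (induction I rule: infinite_finite_induct) (auto simp: \<iota>_add)

lemma \<iota>_of_nat: "\<iota> (of_nat n) = of_nat n"
  by (induction n) (auto simp: \<iota>_add)

text \<open>Mirrors \<open>ser_exp\<close>; the truncation is harmless when
  \<open>F $ 0 = 0\<close>.\<close>

definition fexp :: "'r fps \<Rightarrow> 'r fps" where
  "fexp F = Abs_fps (\<lambda>n. \<Sum>j\<le>n. \<iota> (1 / fact j) * (F ^ j) $ n)"

lemma fexp_nth_truncated:
  assumes "F $ 0 = 0" "m \<le> n"
  shows "fexp F $ m = (\<Sum>j\<le>n. \<iota> (1 / fact j) * (F ^ j) $ m)"
  unfolding fexp_def fps_nth_Abs_fps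
  by (rule sum.mono_neutral_left) (use assms in \<open>auto simp: fps_power_nth_eq_0\<close>)

text \<open>Only powers of one element occur, so the product can be collected by total degree
  \<open>s\<close>; the coefficient of \<open>F ^ s\<close> is an alternating sum of inverse
  factorials.\<close>

lemma fexp_mult_fexp_minus:
  assumes F: "F $ 0 = 0"
  shows "fexp F * fexp (- F) = 1"
proof (rule fps_ext)
  fix n
  let ?q = "\<lambda>i j. \<iota> ((1 / fact i) * ((- 1) ^ j / fact j))"
  have neg: "((- F) ^ j) $ m = \<iota> ((- 1) ^ j) * (F ^ j) $ m" for j m
    by (cases "even j") (simp_all add: \<iota>_minus)
  have tm: "(\<Sum>m\<le>n. (\<iota> (1 / fact i) * (F ^ i) $ m) * (\<iota> (1 / fact j) * ((- F) ^ j) $ (n - m)))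
      = ?q i j * (F ^ (i + j)) $ n" for i j
  proof -
    have "(\<iota> (1 / fact i) * (F ^ i) $ m) * (\<iota> (1 / fact j) * ((- F) ^ j) $ (n - m))
        = ?q i j * ((F ^ i) $ m * (F ^ j) $ (n - m))" for m
    proof -
      have "\<iota> (1 / fact j) * ((- F) ^ j) $ (n - m) = \<iota> ((- 1) ^ j / fact j) * (F ^ j) $ (n - m)"
        unfolding neg mult.assoc[symmetric] \<iota>_mult[symmetric] by simp
      then show ?thesis
        unfolding \<iota>_mult by (simp add: mult.assoc central_left_commute[OF \<iota>_central, of "(F ^ i) $ m"])
    qed
    then show ?thesis
      by (simp add: power_add fps_mult_nth sum_distrib_left atLeast0AtMost)
  qed
  have "(fexp F * fexp (- F)) $ n = (\<Sum>m\<le>n. fexp F $ m * fexp (- F) $ (n - m))"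
    by (simp add: fps_mult_nth atLeast0AtMost)
  also have "\<dots> = (\<Sum>m\<le>n. (\<Sum>i\<le>n. \<iota> (1 / fact i) * (F ^ i) $ m) * (\<Sum>j\<le>n. \<iota> (1 / fact j) * ((- F) ^ j) $ (n - m)))"
    \<comment> \<open>A common bound \<open>n\<close> for all truncations makes the ranges
      independent of \<open>m\<close>, so the sums can be exchanged.\<close>
    using F by (intro sum.cong refl arg_cong2[where f = "(*)"] fexp_nth_truncated) auto
  also have "\<dots> = (\<Sum>i\<le>n. \<Sum>j\<le>n. ?q i j * (F ^ (i + j)) $ n)"
    unfolding sum_product tm[symmetric]
    by (rule trans[OF sum.swap]) (rule sum.cong[OF refl sum.swap])
  also have "\<dots> = (\<Sum>i\<le>n. \<Sum>j\<le>n - i. ?q i j * (F ^ (i + j)) $ n)"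
  proof (rule sum.cong[OF refl], rule sum.mono_neutral_right)
    fix i assume "i \<in> {..n}"
    show "\<forall>j\<in>{..n} - {..n - i}. ?q i j * (F ^ (i + j)) $ n = 0"
    proof
      fix j assume "j \<in> {..n} - {..n - i}"
      then have "n < i + j" by auto
      then show "?q i j * (F ^ (i + j)) $ n = 0" by (simp add: fps_power_nth_eq_0[OF F])
    qed
  qed auto
  also have "\<dots> = (\<Sum>(i, j)\<in>{(i, j). i + j \<le> n}. ?q i j * (F ^ (i + j)) $ n)"
    by (subst sum.Sigma) (auto intro!: sum.cong)
  also have "\<dots> = (\<Sum>s\<le>n. \<Sum>i\<le>s. ?q i (s - i) * (F ^ s) $ n)"
    by (simp add: sum.triangle_reindex_eq)
  also have "\<dots> = (\<Sum>s\<le>n. (if s = 0 then 1 else 0) * (F ^ s) $ n)"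
    unfolding sum_distrib_right[symmetric] \<iota>_sum[symmetric] sum_alternating_inverse_fact
    by (intro sum.cong refl) simp
  also have "\<dots> = (1 :: 'r fps) $ n"
    by (simp add: if_distrib[of "\<lambda>x. x * _"] cong: if_cong)
  finally show "(fexp F * fexp (- F)) $ n = (1 :: 'r fps) $ n" .
qed

end

section \<open>Linear operators on a Hilbert space\<close>

lemma cinner_scaleC_left: "cinner (a *\<^sub>C x) y = cnj a * cinner x (y :: 'h::chilbert_space)"
  by (metis cinner_commute cinner_scaleC_right complex_cnj_mult)

lemma cinner_add_left: "cinner (x + y) z = cinner x z + cinner y (z :: 'h::chilbert_space)"
  by (metis cinner_commute cinner_add_right complex_cnj_add)

lemma cinner_zero_right [simp]: "cinner x (0 :: 'h::chilbert_space) = 0"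
  using cinner_add_right[of x 0 0] by simp

lemma cinner_zero_left [simp]: "cinner 0 (x :: 'h::chilbert_space) = 0"
  using cinner_add_left[of 0 0 x] by simp

lemma cinner_minus_right: "cinner x (- y) = - cinner x (y :: 'h::chilbert_space)"
  using cinner_add_right[of x "- y" y] by (simp add: eq_neg_iff_add_eq_0)

lemma cinner_diff_right: "cinner x (y - z) = cinner x y - cinner x (z :: 'h::chilbert_space)"
  using cinner_add_right[of x y "- z"] by (simp add: cinner_minus_right)

lemma cinner_sum_right: "cinner x (sum f I) = (\<Sum>i\<in>I. cinner x (f i :: 'h::chilbert_space))"
  by (induction I rule: infinite_finite_induct) (auto simp: cinner_add_right)

lemma norm_sum_orthogonal:
  fixes x y :: "'h::chilbert_space"
  assumes "cinner x y = 0"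
  shows "(norm (x + y))\<^sup>2 = (norm x)\<^sup>2 + (norm y)\<^sup>2"
proof -
  have "cinner y x = 0" using assms by (metis cinner_commute complex_cnj_zero)
  then have "cinner (x + y) (x + y) = cinner x x + cinner y y"
    using assms by (simp add: cinner_add_left cinner_add_right)
  then have "complex_of_real ((norm (x + y))\<^sup>2) = complex_of_real ((norm x)\<^sup>2 + (norm y)\<^sup>2)"
    by (simp only: cinner_self of_real_add)
  then show ?thesis using of_real_eq_iff by blast
qed

text \<open>If \<open>z \<noteq> 0\<close>, some \<open>s\<close> in \<open>S\<close> is closer to
  \<open>z\<close> than 0 is; but \<open>s\<close> is orthogonal to \<open>z\<close>, so by
  Pythagoras its distance is at least \<open>norm z\<close>.\<close>

lemma orthogonal_dense_eq_0:
  fixes z :: "'h::chilbert_space"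
  assumes "closure S = UNIV" "\<And>s. s \<in> S \<Longrightarrow> cinner s z = 0"
  shows "z = 0"
proof (rule ccontr)
  assume "z \<noteq> 0"
  then obtain s where s: "s \<in> S" "dist s z < norm z"
    using assms(1) by (metis UNIV_I closure_approachable zero_less_norm_iff)
  have "cinner (- s) z = 0"
    using assms(2)[OF s(1)] cinner_scaleC_left[of "- 1" s z] by simp
  then have "(norm (- s + z))\<^sup>2 = (norm s)\<^sup>2 + (norm z)\<^sup>2"
    using norm_sum_orthogonal[of "- s" z] by simp
  then have "(norm z)\<^sup>2 \<le> (dist s z)\<^sup>2"
    by (simp add: dist_norm norm_minus_commute)
  then show False using s(2) by (simp add: power2_le_iff_abs_le)
qed

text \<open>The complex component keeps \<open>0\<close> and \<open>1\<close> apart when the Hilbert space is trivial.\<close>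

typedef (overloaded) 'h endo = "{(f :: 'h::chilbert_space \<Rightarrow> 'h, z :: complex). clinear_on UNIV f}"
  by (rule exI[of _ "(\<lambda>x. 0, 0)"]) (simp add: clinear_on_def)

setup_lifting type_definition_endo

instantiation endo :: (chilbert_space) ring_1
begin

lift_definition zero_endo :: "'a endo" is "(\<lambda>x. 0, 0)"
  by (simp add: clinear_on_def)

lift_definition one_endo :: "'a endo" is "(\<lambda>x. x, 1)"
  by (simp add: clinear_on_def)

lift_definition plus_endo :: "'a endo \<Rightarrow> 'a endo \<Rightarrow> 'a endo"
  is "\<lambda>(f, a) (g, b). (\<lambda>x. f x + g x, a + b)"
  by (auto simp: clinear_on_def scaleC_add_right)

lift_definition uminus_endo :: "'a endo \<Rightarrow> 'a endo" is "\<lambda>(f, a). (\<lambda>x. - f x, - a)"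
  by (auto simp: clinear_on_def)

lift_definition minus_endo :: "'a endo \<Rightarrow> 'a endo \<Rightarrow> 'a endo"
  is "\<lambda>(f, a) (g, b). (\<lambda>x. f x - g x, a - b)"
  by (auto simp: clinear_on_def complex_vector.scale_right_diff_distrib)

lift_definition times_endo :: "'a endo \<Rightarrow> 'a endo \<Rightarrow> 'a endo"
  is "\<lambda>(f, a) (g, b). (\<lambda>x. f (g x), a * b)"
  by (auto simp: clinear_on_def)

instance
  by standard (transfer; auto simp: clinear_on_def algebra_simps)+

end

lift_definition endo_apply :: "'h::chilbert_space endo \<Rightarrow> 'h \<Rightarrow> 'h" is fst .

lift_definition scalar_endo :: "complex \<Rightarrow> 'h::chilbert_space endo" is "\<lambda>c. (\<lambda>x. c *\<^sub>C x, c)"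
  by (auto simp: clinear_on_def scaleC_add_right mult.commute)

lemma endo_apply_simps [simp]:
  "endo_apply 0 x = 0" "endo_apply 1 x = x"
  "endo_apply (a + b) x = endo_apply a x + endo_apply b x"
  "endo_apply (a - b) x = endo_apply a x - endo_apply b x"
  "endo_apply (- a) x = - endo_apply a x"
  "endo_apply (a * b) x = endo_apply a (endo_apply b x)"
  "endo_apply (scalar_endo c) x = c *\<^sub>C x"
  by (transfer; auto)+

lemma endo_apply_sum [simp]: "endo_apply (sum f I) x = (\<Sum>i\<in>I. endo_apply (f i) x)"
  by (induction I rule: infinite_finite_induct) auto

lemma endo_apply_linear:
  "endo_apply a (x + y) = endo_apply a x + endo_apply a y" "endo_apply a (c *\<^sub>C x) = c *\<^sub>C endo_apply a x"
  by (transfer; auto simp: clinear_on_def)+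

interpretation endo: central_scalars "scalar_endo :: complex \<Rightarrow> 'h::chilbert_space endo"
  by standard (transfer; auto simp: clinear_on_def scaleC_add_left)+

lemma clinear_on_0: "clinear_on S A \<Longrightarrow> 0 \<in> S \<Longrightarrow> A 0 = 0"
  by (metis add_cancel_right_right clinear_on_def)

section \<open>Operators on an invariant subspace as ring elements\<close>

locale invariant_subspace =
  fixes S :: "'h::chilbert_space set"
  assumes csubspace_S: "csubspace S"
begin

text \<open>The inclusion of \<open>S\<close> has a linear left inverse; the projection is purely
  algebraic.\<close>

lemma ex_projection: "\<exists>P. clinear_on UNIV P \<and> range P \<subseteq> S \<and> (\<forall>x\<in>S. P x = x)"
proof -
  interpret vector_space_pair "scaleC :: complex \<Rightarrow> 'h \<Rightarrow> 'h" "scaleC :: complex \<Rightarrow> 'h \<Rightarrow> 'h" ..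
  obtain P where P: "range P \<subseteq> S" "Vector_Spaces.linear scaleC scaleC P" "\<forall>x\<in>S. P (id x) = x"
    using linear_exists_left_inverse_on[OF complex_vector.linear_id csubspace_S[unfolded csubspace_def] inj_on_id] by blast
  then have "clinear_on UNIV P \<and> range P \<subseteq> S \<and> (\<forall>x\<in>S. P x = x)"
    using linear_add[OF P(2)] linear_scale[OF P(2)] by (simp add: clinear_on_def)
  then show ?thesis by blast
qed

definition proj :: "'h \<Rightarrow> 'h" where
  "proj = (SOME P. clinear_on UNIV P \<and> range P \<subseteq> S \<and> (\<forall>x\<in>S. P x = x))"

lemma proj: "clinear_on UNIV proj" "proj x \<in> S" "x \<in> S \<Longrightarrow> proj x = x"
  using someI_ex[OF ex_projection] unfolding proj_def[symmetric] by auto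

definition operator :: "('h \<Rightarrow> 'h) \<Rightarrow> bool" where
  "operator A \<longleftrightarrow> clinear_on S A \<and> A ` S \<subseteq> S"

text \<open>\<open>A\<close> is only meaningful on \<open>S\<close>, and \<open>proj\<close> makes
  it total. With second component 0 the embedded operators form a corner of the ring, whose unit is
  \<open>corner_unit\<close> and not 1.\<close>

definition embed :: "('h \<Rightarrow> 'h) \<Rightarrow> 'h endo" where
  "embed A = Abs_endo (\<lambda>x. A (proj x), 0)"

lemma operator_closed: "operator A \<Longrightarrow> x \<in> S \<Longrightarrow> A x \<in> S"
  by (auto simp: operator_def)

lemma Rep_embed:
  assumes "operator A"
  shows "Rep_endo (embed A) = (\<lambda>x. A (proj x), 0)"
  unfolding embed_def using assms proj
  by (intro Abs_endo_inverse) (auto simp: operator_def clinear_on_def)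

lemma endo_apply_embed: "operator A \<Longrightarrow> endo_apply (embed A) x = A (proj x)"
  by (simp add: endo_apply.rep_eq Rep_embed)

lemma endo_apply_embed_S [simp]: "operator A \<Longrightarrow> x \<in> S \<Longrightarrow> endo_apply (embed A) x = A x"
  by (simp add: endo_apply_embed proj)

definition corner_unit :: "'h endo" where
  "corner_unit = embed (\<lambda>x. x)"

lemma operator_id: "operator (\<lambda>x. x)"
  by (auto simp: operator_def clinear_on_def)

lemma endo_apply_corner_unit: "endo_apply corner_unit x = proj x"
  by (simp add: corner_unit_def endo_apply_embed operator_id)

lemma endo_eqI:
  assumes "\<And>x. endo_apply a x = endo_apply b x" "snd (Rep_endo a) = snd (Rep_endo b)"
  shows "a = b"
  using assms by (simp add: endo_apply.rep_eq Rep_endo_inject[symmetric] prod_eq_iff fun_eq_iff)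

lemma Rep_endo_mult: "snd (Rep_endo (a * b)) = snd (Rep_endo a) * snd (Rep_endo b)"
  by (simp add: times_endo.rep_eq case_prod_unfold)

lemma embed_corner [simp]:
  assumes "operator A"
  shows "embed A * corner_unit = embed A" "corner_unit * embed A = embed A"
  using assms operator_closed[OF assms] proj
  by (auto intro!: endo_eqI simp: endo_apply_corner_unit endo_apply_embed Rep_endo_mult Rep_embed)

text \<open>Right multiplication by \<open>corner_unit\<close> precomposes with \<open>proj\<close>
  and erases the second component. This turns identities on \<open>S\<close> into identities in the
  ring.\<close>

lemma mult_corner_eqI:
  assumes "\<And>x. x \<in> S \<Longrightarrow> endo_apply a x = endo_apply b x"
  shows "a * corner_unit = b * corner_unit"
proof (rule endo_eqI)
  show "endo_apply (a * corner_unit) x = endo_apply (b * corner_unit) x" for x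
    by (simp add: assms proj endo_apply_corner_unit)
qed (simp add: Rep_endo_mult corner_unit_def Rep_embed operator_id)

text \<open>A map commuting with a projection preserves its range. In this form invariance of
  \<open>S\<close> passes to products, inverses and exponentials.\<close>

lemma commutes_corner_closed:
  assumes "a * corner_unit = corner_unit * a" "x \<in> S"
  shows "endo_apply a x \<in> S"
proof -
  have "endo_apply a x = endo_apply (a * corner_unit) x"
    by (simp add: endo_apply_corner_unit proj assms(2))
  also have "\<dots> = proj (endo_apply a x)"
    by (simp add: assms(1) endo_apply_corner_unit)
  finally show ?thesis using proj(2) by metis
qed

text \<open>Links operator series, compared on \<open>S\<close> only, to power series over the ring.
  Invariance of \<open>S\<close> is included because products compose coefficients.\<close>

definition represents :: "'h endo fps \<Rightarrow> 'h opseries \<Rightarrow> bool" where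
  "represents F A \<longleftrightarrow> (\<forall>n. \<forall>x\<in>S. endo_apply (fps_nth F n) x = A n x \<and> A n x \<in> S)"

lemma S_0 [simp]: "0 \<in> S" and S_scale: "x \<in> S \<Longrightarrow> c *\<^sub>C x \<in> S" and S_add: "x \<in> S \<Longrightarrow> y \<in> S \<Longrightarrow> x + y \<in> S"
  and S_sum: "(\<And>i. i \<in> I \<Longrightarrow> f i \<in> S) \<Longrightarrow> sum f I \<in> S" and S_diff: "x \<in> S \<Longrightarrow> y \<in> S \<Longrightarrow> x - y \<in> S"
  using csubspace_S complex_vector.subspace_0 complex_vector.subspace_scale
    complex_vector.subspace_add complex_vector.subspace_sum complex_vector.subspace_diff by metis+

lemma represents_mult:
  assumes "represents F A" "represents G B"
  shows "represents (F * G) (ser_mult A B)"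
  using assms by (auto simp: represents_def ser_mult_def fps_mult_nth atLeast0AtMost intro!: S_sum)

lemma represents_power:
  assumes "represents F A"
  shows "represents (F ^ j) (ser_power A j)"
proof (induction j)
  case 0
  show ?case by (auto simp: represents_def ser_one_def)
qed (use assms represents_mult in simp)

lemma represents_exp:
  assumes "represents F A"
  shows "represents (endo.fexp F) (ser_exp A)"
  using represents_power[OF assms]
  by (auto simp: represents_def ser_exp_def endo.fexp_def intro!: S_sum S_scale)

lemma represents_scale:
  assumes "represents F A"
  shows "represents (fps_const (scalar_endo c) * F) (ser_scale c A)"
  using assms by (auto simp: represents_def ser_scale_def intro!: S_scale)

end

section \<open>Homogeneous components in an eigenbasis\<close>

locale eigenbasis =
  fixes J :: "nat set" and E0 :: "nat \<Rightarrow> real" and e :: "nat \<Rightarrow> 'h::chilbert_space" and H0 :: "'h \<Rightarrow> 'h"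
  assumes orthonormal: "m \<in> J \<Longrightarrow> n \<in> J \<Longrightarrow> cinner (e m) (e n) = (if m = n then 1 else 0)"
    and dense: "closure (cspan (e ` J)) = UNIV"
    and simple: "inj_on E0 J"
    and linear_H0: "clinear_on (cspan (e ` J)) H0"
    and eigen: "n \<in> J \<Longrightarrow> H0 (e n) = complex_of_real (E0 n) *\<^sub>C e n"
begin

sublocale invariant_subspace "cspan (e ` J)"
  by standard (rule complex_vector.subspace_span)

abbreviation S where "S \<equiv> cspan (e ` J)"

lemma e_in_S [simp]: "n \<in> J \<Longrightarrow> e n \<in> S"
  by (rule complex_vector.span_base) simp

lemma S_induct [consumes 1, case_names zero add]:
  assumes "x \<in> S" "P 0" "\<And>c n x. n \<in> J \<Longrightarrow> x \<in> S \<Longrightarrow> P x \<Longrightarrow> P (c *\<^sub>C e n + x)"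
  shows "P x"
proof -
  have "x \<in> S \<and> P x"
    using assms(1)
  proof (induction rule: complex_vector.span_induct_alt)
    case (step c b y)
    then show ?case using assms(3) S_add S_scale by auto
  qed (use assms(2) in simp)
  then show ?thesis ..
qed

lemma linear_on_S_eqI:
  assumes "clinear_on S A" "clinear_on S B" "\<And>n. n \<in> J \<Longrightarrow> A (e n) = B (e n)" "x \<in> S"
  shows "A x = B x"
  using assms(4)
proof (induction rule: S_induct)
  case zero
  then show ?case using clinear_on_0[OF assms(1)] clinear_on_0[OF assms(2)] by simp
next
  case (add c n x)
  then show ?case using assms(1-3) S_scale by (simp add: clinear_on_def)
qed

lemma operatorI:
  assumes A: "clinear_on S A" and "\<And>n. n \<in> J \<Longrightarrow> A (e n) \<in> S"
  shows "operator A"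
proof -
  have "A x \<in> S" if "x \<in> S" for x
    using that
  proof (induction rule: S_induct)
    case (add c n x)
    have "A (c *\<^sub>C e n + x) = c *\<^sub>C A (e n) + A x"
      using A add S_scale by (simp add: clinear_on_def)
    then show ?case using assms(2) add S_add S_scale by metis
  qed (use clinear_on_0[OF A] in simp)
  then show ?thesis using A by (auto simp: operator_def)
qed

lemma operator_H0: "operator H0"
  by (rule operatorI[OF linear_H0]) (simp add: eigen S_scale)

lemma orthogonal_basis_eq_0:
  assumes "\<And>n. n \<in> J \<Longrightarrow> cinner (e n) z = 0"
  shows "z = 0"
proof (rule orthogonal_dense_eq_0[OF dense])
  fix s assume "s \<in> S"
  then show "cinner s z = 0"
    by (induction rule: S_induct) (simp_all add: cinner_add_left cinner_scaleC_left assms)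
qed

lemma cinner_H0:
  assumes "n \<in> J" "x \<in> S"
  shows "cinner (e n) (H0 x) = complex_of_real (E0 n) * cinner (e n) x"
  using assms(2)
proof (induction rule: S_induct)
  case zero
  then show ?case using clinear_on_0[OF linear_H0] by simp
next
  case (add c m x)
  have "H0 (c *\<^sub>C e m + x) = c *\<^sub>C H0 (e m) + H0 x"
    using linear_H0 add S_scale by (simp add: clinear_on_def)
  then show ?case
    using add assms(1) by (simp add: cinner_add_right cinner_scaleC_right eigen orthonormal algebra_simps)
qed

text \<open>The spectrum is simple: a component along another \<open>e m\<close> would have to
  satisfy the eigenvalue equation for both \<open>E0 m\<close> and \<open>E0 n\<close>.\<close>

lemma eigenvector_multiple:
  assumes "n \<in> J" "x \<in> S" "H0 x = complex_of_real (E0 n) *\<^sub>C x"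
  shows "x = cinner (e n) x *\<^sub>C e n"
proof -
  have "x - cinner (e n) x *\<^sub>C e n = 0"
  proof (rule orthogonal_basis_eq_0)
    fix m assume m: "m \<in> J"
    show "cinner (e m) (x - cinner (e n) x *\<^sub>C e n) = 0"
    proof (cases "m = n")
      case False
      have "complex_of_real (E0 m) * cinner (e m) x = complex_of_real (E0 n) * cinner (e m) x"
        using cinner_H0[OF m assms(2), symmetric] unfolding assms(3) cinner_scaleC_right .
      moreover have "E0 m \<noteq> E0 n" using False m assms(1) simple by (auto dest: inj_onD)
      ultimately have "cinner (e m) x = 0" by auto
      then show ?thesis using False m assms(1) by (simp add: cinner_diff_right cinner_scaleC_right orthonormal)
    qed (use m in \<open>simp add: cinner_diff_right cinner_scaleC_right orthonormal\<close>)
  qed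
  then show ?thesis by simp
qed

lemma commuting_diagonal:
  assumes A: "operator A" and comm: "\<And>x. x \<in> S \<Longrightarrow> H0 (A x) = A (H0 x)" and n: "n \<in> J"
  shows "A (e n) = cinner (e n) (A (e n)) *\<^sub>C e n"
proof (rule eigenvector_multiple[OF n])
  show "A (e n) \<in> S" using A n by (simp add: operator_closed)
  have "A (c *\<^sub>C e n) = c *\<^sub>C A (e n)" for c
    using A n by (simp add: operator_def clinear_on_def)
  then show "H0 (A (e n)) = complex_of_real (E0 n) *\<^sub>C A (e n)"
    using comm n by (simp add: eigen)
qed

text \<open>
  Everything commuting with \<open>H\<^sub>0\<close> is diagonal. At order \<open>k\<close> the \<open>n\<close>-th diagonal entry of the equation
  forces the eigenvalues of \<open>A\<close> and \<open>B\<close> to agree, after which \<open>Y\<^sub>k\<close> commutes with \<open>H\<^sub>0\<close>.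
\<close>

lemma normal_form_unique:
  fixes Y A B :: "'h endo fps"
  assumes eq: "Y * (fps_const (embed H0) + A) = (fps_const (embed H0) + B) * Y"
    and Y0: "fps_nth Y 0 = 1" and A0: "fps_nth A 0 = 0" and B0: "fps_nth B 0 = 0"
    and Y: "\<And>k x. x \<in> S \<Longrightarrow> endo_apply (fps_nth Y k) x \<in> S"
    and A: "\<And>k n. n \<in> J \<Longrightarrow> endo_apply (fps_nth A k) (e n) = \<alpha> k n *\<^sub>C e n"
    and B: "\<And>k n. n \<in> J \<Longrightarrow> endo_apply (fps_nth B k) (e n) = \<beta> k n *\<^sub>C e n"
    and n: "n \<in> J"
  shows "endo_apply (fps_nth A k) (e n) = endo_apply (fps_nth B k) (e n)"
proof -
  \<comment> \<open>The induction also carries that \<open>Y\<close> is diagonal up to order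
    \<open>k\<close>, which makes the lower-order terms of both sides comparable.\<close>
  have "\<alpha> k n *\<^sub>C e n = \<beta> k n *\<^sub>C e n \<and> (\<exists>y. endo_apply (fps_nth Y k) (e n) = y *\<^sub>C e n)" for k
  proof (induction k rule: less_induct)
    case (less k)
    show ?case
    proof (cases "k = 0")
      case True
      have "\<alpha> 0 n *\<^sub>C e n = 0" "\<beta> 0 n *\<^sub>C e n = 0"
        using A[OF n, of 0] B[OF n, of 0] A0 B0 by simp_all
      moreover have "endo_apply (fps_nth Y 0) (e n) = 1 *\<^sub>C e n" by (simp add: Y0)
      ultimately show ?thesis using True by metis
    next
      case False
      let ?Yk = "endo_apply (fps_nth Y k) (e n)"
      have "\<exists>y. \<forall>i<k. endo_apply (fps_nth Y i) (e n) = y i *\<^sub>C e n"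
        using less by metis
      then obtain y where y: "\<And>i. i < k \<Longrightarrow> endo_apply (fps_nth Y i) (e n) = y i *\<^sub>C e n"
        by blast
      have "endo_apply (fps_nth (Y * (fps_const (embed H0) + A)) k) (e n) =
         endo_apply (fps_nth Y k) (H0 (e n)) + (\<Sum>i\<le>k. endo_apply (fps_nth Y i) (\<alpha> (k - i) n *\<^sub>C e n))"
        by (simp add: distrib_left fps_mult_nth[of Y A] atLeast0AtMost A n operator_H0)
      also have "(\<Sum>i\<le>k. endo_apply (fps_nth Y i) (\<alpha> (k - i) n *\<^sub>C e n)) =
         (\<Sum>i<k. (\<alpha> (k - i) n * y i) *\<^sub>C e n)"
      proof -
        have "\<alpha> 0 n *\<^sub>C e n = 0" using A[OF n, of 0] A0 by simp
        moreover have "endo_apply (fps_nth Y k) 0 = 0"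
          using endo_apply_linear(2)[of "fps_nth Y k" 0 0] by simp
        ultimately have "endo_apply (fps_nth Y k) (\<alpha> 0 n *\<^sub>C e n) = 0"
          by (simp only:)
        then show ?thesis
          by (simp add: lessThan_Suc_atMost[symmetric] endo_apply_linear(2) y)
      qed
      finally have L: "endo_apply (fps_nth (Y * (fps_const (embed H0) + A)) k) (e n) =
         complex_of_real (E0 n) *\<^sub>C ?Yk + (\<Sum>i<k. (\<alpha> (k - i) n * y i) *\<^sub>C e n)"
        by (simp add: eigen n endo_apply_linear(2))
      have "endo_apply (fps_nth ((fps_const (embed H0) + B) * Y) k) (e n) =
         H0 ?Yk + (\<Sum>i\<le>k. endo_apply (fps_nth B (k - i)) (endo_apply (fps_nth Y i) (e n)))"
      proof -
        have "fps_nth (B * Y) k = (\<Sum>i\<le>k. fps_nth B (k - i) * fps_nth Y i)"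
          unfolding fps_mult_nth atLeast0AtMost
          by (rule sum.reindex_bij_witness[of _ "\<lambda>i. k - i" "\<lambda>i. k - i"]) auto
        then show ?thesis using Y n by (simp add: distrib_right operator_H0)
      qed
      also have "(\<Sum>i\<le>k. endo_apply (fps_nth B (k - i)) (endo_apply (fps_nth Y i) (e n))) =
         (\<Sum>i<k. (\<beta> (k - i) n * y i) *\<^sub>C e n)"
        by (simp add: lessThan_Suc_atMost[symmetric] endo_apply_linear(2) y B n B0 mult.commute)
      finally have R: "endo_apply (fps_nth ((fps_const (embed H0) + B) * Y) k) (e n) =
         H0 ?Yk + (\<Sum>i<k. (\<beta> (k - i) n * y i) *\<^sub>C e n)" .
      \<comment> \<open>The term \<open>i = 0\<close> holds the unknown eigenvalue of order
        \<open>k\<close>; the other terms agree by induction.\<close>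
      have split: "(\<Sum>i<k. f i) = f 0 + (\<Sum>i\<in>{1..<k}. f i)" for f :: "nat \<Rightarrow> 'h"
        using False by (simp add: lessThan_atLeast0 sum.atLeast_Suc_lessThan)
      have "y 0 *\<^sub>C e n = e n" using y[of 0] False by (simp add: Y0)
      then have y0: "(c * y 0) *\<^sub>C e n = c *\<^sub>C e n" for c
        by (simp only: scaleC_scaleC[symmetric])
      have tail: "(\<Sum>i\<in>{1..<k}. (\<alpha> (k - i) n * y i) *\<^sub>C e n) = (\<Sum>i\<in>{1..<k}. (\<beta> (k - i) n * y i) *\<^sub>C e n)"
      proof (intro sum.cong refl)
        fix i assume "i \<in> {1..<k}"
        then have "\<alpha> (k - i) n *\<^sub>C e n = \<beta> (k - i) n *\<^sub>C e n" using less[of "k - i"] by simp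
        then have "y i *\<^sub>C \<alpha> (k - i) n *\<^sub>C e n = y i *\<^sub>C \<beta> (k - i) n *\<^sub>C e n" by simp
        then show "(\<alpha> (k - i) n * y i) *\<^sub>C e n = (\<beta> (k - i) n * y i) *\<^sub>C e n"
          by (simp add: scaleC_scaleC mult.commute)
      qed
      have main: "complex_of_real (E0 n) *\<^sub>C ?Yk + \<alpha> k n *\<^sub>C e n = H0 ?Yk + \<beta> k n *\<^sub>C e n"
        using L R tail unfolding eq split by (simp add: y0)
      \<comment> \<open>Pairing with \<open>e n\<close> produces \<open>E0 n\<close> times the same
        number on both sides, so \<open>Y\<close> drops out.\<close>
      have "cinner (e n) (complex_of_real (E0 n) *\<^sub>C ?Yk + \<alpha> k n *\<^sub>C e n) = cinner (e n) (H0 ?Yk + \<beta> k n *\<^sub>C e n)"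
        by (simp only: main)
      then have ab: "\<alpha> k n = \<beta> k n"
        using n Y by (simp add: cinner_add_right cinner_scaleC_right cinner_H0 orthonormal)
      then have "H0 ?Yk = complex_of_real (E0 n) *\<^sub>C ?Yk" using main by simp
      then have "?Yk = cinner (e n) ?Yk *\<^sub>C e n"
        using n Y by (intro eigenvector_multiple) auto
      then show ?thesis using ab by metis
    qed
  qed
  then show ?thesis by (simp add: A B n)
qed

end

section \<open>Homogeneous components of the perturbation\<close>

locale perturbed = eigenbasis J E0 e H0
  for J :: "nat set" and E0 :: "nat \<Rightarrow> real" and e :: "nat \<Rightarrow> 'h::chilbert_space" and H0 :: "'h \<Rightarrow> 'h" +
  fixes hbar :: real and V :: "'h \<Rightarrow> 'h"
  assumes hbar: "hbar > 0"
    and linear_V: "clinear_on UNIV V"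
    and finite_band: "finite {lam \<in> frequencies hbar J E0. \<exists>x\<in>cspan (e ` J). hom_component hbar J E0 e V lam x \<noteq> 0}"
begin

abbreviation component :: "complex \<Rightarrow> 'h \<Rightarrow> 'h" where
  "component \<equiv> hom_component hbar J E0 e V"

definition ih :: complex where "ih = \<i> * complex_of_real hbar"

lemma ih_nonzero [simp]: "ih \<noteq> 0"
  using hbar by (simp add: ih_def)

definition band :: "complex set" where
  "band = {lam \<in> frequencies hbar J E0. \<exists>x\<in>S. component lam x \<noteq> 0}"

lemma finite_band' [simp]: "finite band"
  using finite_band by (simp add: band_def)

lemma band_subset: "band \<subseteq> frequencies hbar J E0"
  by (auto simp: band_def)

definition targets :: "complex \<Rightarrow> nat \<Rightarrow> nat set" where
  "targets lam k = {l \<in> J. complex_of_real (E0 l - E0 k) = ih * lam}"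

text \<open>The source index and the frequency determine the target eigenvalue, hence, by simplicity
  of the spectrum, the target index.\<close>

lemma targets_cases: "targets lam k = {} \<or> (\<exists>l. targets lam k = {l})"
proof (cases "targets lam k = {}")
  case False
  then obtain l where l: "l \<in> targets lam k" by blast
  have "m = l" if "m \<in> targets lam k" for m
  proof -
    have "complex_of_real (E0 m - E0 k) = complex_of_real (E0 l - E0 k)"
      using l that by (simp add: targets_def)
    then have "E0 m = E0 l" by simp
    then show ?thesis using l that simple by (auto simp: targets_def dest: inj_onD)
  qed
  then show ?thesis using l by blast
qed simp

lemma finite_targets [simp]: "finite (targets lam k)"
  using targets_cases[of lam k] by auto

definition column :: "complex \<Rightarrow> nat \<Rightarrow> 'h" where
  "column lam k = (\<Sum>l\<in>targets lam k. cinner (e l) (V (e k)) *\<^sub>C e l)"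

lemma column_in_S: "column lam k \<in> S"
  by (auto simp: column_def targets_def intro!: S_sum S_scale)

lemma H0_column:
  assumes "k \<in> J"
  shows "H0 (column lam k) = (complex_of_real (E0 k) + ih * lam) *\<^sub>C column lam k"
proof (cases "targets lam k = {}")
  case True
  then have "column lam k = 0" by (simp add: column_def)
  then show ?thesis using clinear_on_0[OF linear_H0] by simp
next
  case False
  then obtain l where l: "targets lam k = {l}" using targets_cases by blast
  then have lJ: "l \<in> J" and "complex_of_real (E0 l - E0 k) = ih * lam" by (auto simp: targets_def)
  then have E: "complex_of_real (E0 l) = complex_of_real (E0 k) + ih * lam"
    by (simp add: algebra_simps)
  have "H0 (c *\<^sub>C e l) = c *\<^sub>C H0 (e l)" for c
    using linear_H0 lJ by (simp add: clinear_on_def)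
  then show ?thesis
    by (simp add: column_def l eigen lJ E scaleC_scaleC mult.commute)
qed

definition support :: "'h \<Rightarrow> nat set" where
  "support x = {k \<in> J. cinner (e k) x \<noteq> 0}"

lemma finite_support: "x \<in> S \<Longrightarrow> finite (support x)"
proof (induction rule: S_induct)
  case (add c n x)
  have "support (c *\<^sub>C e n + x) \<subseteq> insert n (support x)"
    using add by (auto simp: support_def cinner_add_right cinner_scaleC_right orthonormal split: if_splits)
  then show ?case using add finite_subset by blast
qed (simp add: support_def)

text \<open>Terms with \<open>k\<close> outside the support vanish, so the sum is finite.
  \<open>K\<close> may exceed the support so that two vectors can share one index set.\<close>

lemma component_eq:
  assumes "finite K" "K \<subseteq> J" "support x \<subseteq> K"
  shows "component lam x = (\<Sum>k\<in>K. cinner (e k) x *\<^sub>C column lam k)"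
proof -
  let ?f = "\<lambda>(k, l). (cinner (e l) (V (e k)) * cinner (e k) x) *\<^sub>C e l"
  have "component lam x = infsum ?f (Sigma K (targets lam))"
    unfolding hom_component_def
    using assms by (intro infsum_cong_neutral) (auto simp: targets_def support_def ih_def)
  also have "\<dots> = (\<Sum>k\<in>K. \<Sum>l\<in>targets lam k. (cinner (e l) (V (e k)) * cinner (e k) x) *\<^sub>C e l)"
    using assms by (simp add: sum.Sigma)
  also have "\<dots> = (\<Sum>k\<in>K. cinner (e k) x *\<^sub>C column lam k)"
    by (simp add: column_def complex_vector.scale_sum_right mult.commute)
  finally show ?thesis .
qed

lemma component_basis: "k \<in> J \<Longrightarrow> component lam (e k) = column lam k"
  by (subst component_eq[of "{k}"]) (auto simp: support_def orthonormal split: if_splits)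

lemma operator_component: "operator (component lam)"
proof (rule operatorI)
  have K: "support (x + y) \<subseteq> support x \<union> support y" "support (c *\<^sub>C x) \<subseteq> support x" "support x \<subseteq> J" for x y c
    by (auto simp: support_def cinner_add_right cinner_scaleC_right)
  show "clinear_on S (component lam)"
    unfolding clinear_on_def
  proof (intro conjI ballI allI)
    fix x y assume "x \<in> S" "y \<in> S"
    then have fin: "finite (support x \<union> support y)" by (simp add: finite_support)
    show "component lam (x + y) = component lam x + component lam y"
      using K by (simp add: component_eq[OF fin] cinner_add_right scaleC_add_left sum.distrib)
  next
    fix c x assume "x \<in> S"
    then show "component lam (c *\<^sub>C x) = c *\<^sub>C component lam x"
      using K by (simp add: component_eq[OF finite_support] cinner_scaleC_right
          complex_vector.scale_sum_right scaleC_scaleC)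
  qed
qed (simp add: component_basis column_in_S)

lemma component_outside_band:
  assumes "lam \<in> frequencies hbar J E0" "lam \<notin> band" "x \<in> S"
  shows "component lam x = 0"
  using assms by (auto simp: band_def)

text \<open>Compare entries against \<open>e l\<close>: only one frequency leads from
  \<open>e k\<close> to \<open>e l\<close>, and if it is not in \<open>band\<close> the entry is
  zero.\<close>

lemma V_basis:
  assumes k: "k \<in> J"
  shows "V (e k) = (\<Sum>lam\<in>band. column lam k)"
proof -
  have "V (e k) - (\<Sum>lam\<in>band. column lam k) = 0"
  proof (rule orthogonal_basis_eq_0)
    fix l assume l: "l \<in> J"
    define lam0 where "lam0 = complex_of_real (E0 l - E0 k) / ih"
    have lam0: "lam0 \<in> frequencies hbar J E0"
    proof -
      have "lam0 = 1 / (\<i> * complex_of_real hbar) * complex_of_real (E0 l - E0 k)"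
        by (simp add: lam0_def ih_def)
      then show ?thesis using k l unfolding frequencies_def by blast
    qed
    have "cinner (e l) (column lam k) = (if lam = lam0 then cinner (e l) (V (e k)) else 0)" for lam
    proof -
      have "cinner (e l) (column lam k) = (\<Sum>m\<in>targets lam k. if m = l then cinner (e l) (V (e k)) else 0)"
        unfolding column_def cinner_sum_right
        by (intro sum.cong refl) (auto simp: cinner_scaleC_right orthonormal l targets_def)
      moreover have "l \<in> targets lam k \<longleftrightarrow> lam = lam0"
        using l by (auto simp: targets_def lam0_def field_simps)
      ultimately show ?thesis by simp
    qed
    moreover from this[of lam0] have "cinner (e l) (V (e k)) = 0" if "lam0 \<notin> band"
      using component_outside_band[OF lam0 that, of "e k"] k by (simp add: component_basis)
    ultimately show "cinner (e l) (V (e k) - (\<Sum>lam\<in>band. column lam k)) = 0"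
      by (auto simp: cinner_diff_right cinner_sum_right)
  qed
  then show ?thesis by simp
qed

lemma operator_V: "operator V"
proof (rule operatorI)
  show "clinear_on S V" using linear_V by (simp add: clinear_on_def)
qed (simp add: V_basis column_in_S S_sum)

lemma V_eq_sum:
  assumes "x \<in> S"
  shows "V x = (\<Sum>lam\<in>band. component lam x)"
proof (rule linear_on_S_eqI[OF _ _ _ assms])
  show "clinear_on S V" using operator_V by (simp add: operator_def)
  show "clinear_on S (\<lambda>x. \<Sum>lam\<in>band. component lam x)"
    using operator_component
    by (simp add: operator_def clinear_on_def sum.distrib complex_vector.scale_sum_right)
qed (simp add: V_basis component_basis)

lemma component_eigen:
  assumes "x \<in> S"
  shows "H0 (component lam x) = component lam (H0 x) + (ih * lam) *\<^sub>C component lam x"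
proof (rule linear_on_S_eqI[OF _ _ _ assms])
  have c: "clinear_on S (component lam)" "\<And>x. x \<in> S \<Longrightarrow> component lam x \<in> S"
    using operator_component by (auto simp: operator_def)
  have h: "clinear_on S H0" "\<And>x. x \<in> S \<Longrightarrow> H0 x \<in> S"
    using operator_H0 by (auto simp: operator_def)
  show "clinear_on S (\<lambda>x. H0 (component lam x))"
    using c h by (simp add: clinear_on_def)
  show "clinear_on S (\<lambda>x. component lam (H0 x) + (ih * lam) *\<^sub>C component lam x)"
    using c h by (simp add: clinear_on_def scaleC_add_right scaleC_scaleC mult.commute)
  fix n assume n: "n \<in> J"
  have "component lam (complex_of_real (E0 n) *\<^sub>C e n) = complex_of_real (E0 n) *\<^sub>C component lam (e n)"
    using c n by (simp add: clinear_on_def)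
  then show "H0 (component lam (e n)) = component lam (H0 (e n)) + (ih * lam) *\<^sub>C component lam (e n)"
    using n by (simp add: component_basis H0_column eigen scaleC_add_left)
qed

end

section \<open>The normal form as a mould expansion\<close>

lemma nested_bracket_eq_0:
  assumes "a \<in> set w" "x a = 0"
  shows "nested_bracket x w = 0"
  using assms by (induction x w rule: nested_bracket.induct) auto

section \<open>Operator series attached to complex moulds\<close>

context perturbed
begin

text \<open>A word of length k thus carries k factors \<open>1 / ih\<close>, one more than
  \<open>nested_commutator\<close>; hence the factors \<open>scalar_endo ih\<close> below.\<close>

definition letter :: "complex \<Rightarrow> 'h endo" where
  "letter lam = scalar_endo (1 / ih) * embed (component lam)"

definition series :: "(complex list \<Rightarrow> complex) \<Rightarrow> 'h endo fps" where
  "series c = comould_series band letter (\<lambda>w. scalar_endo (c w))"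

lemma series_nth: "fps_nth (series c) k = (\<Sum>w\<in>words band k. scalar_endo (c w) * word_prod letter w)"
  by (simp add: series_def comould_series_nth)

lemma words_band: "w \<in> words band k \<Longrightarrow> w \<in> lists (frequencies hbar J E0)"
  using band_subset by (auto simp: words_def)

lemma series_cong:
  assumes "\<And>w. w \<in> lists (frequencies hbar J E0) \<Longrightarrow> c w = d w"
  shows "series c = series d"
  by (rule fps_ext) (auto simp: series_nth assms words_band intro!: sum.cong)

lemma series_cmul: "series (cmul c d) = series c * series d"
proof -
  have "(\<lambda>w. scalar_endo (cmul c d w) :: 'h endo) = cmul (\<lambda>w. scalar_endo (c w)) (\<lambda>w. scalar_endo (d w))"
    by (intro ext) (simp add: cmul_def endo.\<iota>_sum endo.\<iota>_mult)
  then show ?thesis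
    unfolding series_def by (simp add: comould_series_cmul endo.\<iota>_central)
qed

lemma series_diff: "series (\<lambda>w. c w - d w) = series c - series d"
  by (rule fps_ext) (simp add: series_nth endo.\<iota>_diff left_diff_distrib sum_subtractf)

lemma embed_V: "embed V = (\<Sum>lam\<in>band. embed (component lam))"
proof -
  have "embed V * corner_unit = (\<Sum>lam\<in>band. embed (component lam)) * corner_unit"
    by (rule mult_corner_eqI) (simp add: operator_V operator_component V_eq_sum)
  then show ?thesis by (simp add: operator_V operator_component sum_distrib_right)
qed

lemma series_letter_mould: "fps_const (scalar_endo ih) * series letter_mould = fps_X * fps_const (embed V)"
proof (rule fps_ext)
  fix n
  have "fps_nth (series letter_mould) n = (if n = 1 then scalar_endo (1 / ih) * embed V else 0)"
  proof (cases "n = 1")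
    case True
    have "fps_nth (series letter_mould) (Suc 0) = (\<Sum>lam\<in>band. letter lam)"
      by (simp add: series_nth sum_words_Suc letter_mould_def)
    then show ?thesis using True by (simp add: letter_def embed_V sum_distrib_left)
  next
    case False
    then show ?thesis by (auto simp: series_nth letter_mould_def words_def)
  qed
  then show "fps_nth (fps_const (scalar_endo ih) * series letter_mould) n = fps_nth (fps_X * fps_const (embed V)) n"
    by (auto simp: mult.assoc[symmetric] endo.\<iota>_mult[symmetric])
qed

lemma H0_letter: "embed H0 * letter lam = letter lam * embed H0 + scalar_endo (ih * lam) * letter lam"
proof -
  let ?C = "embed (component lam)"
  have "embed H0 * ?C * corner_unit = (?C * embed H0 + scalar_endo (ih * lam) * ?C) * corner_unit"
    by (rule mult_corner_eqI)
       (simp add: operator_H0 operator_component component_eigen operator_closed)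
  then have "embed H0 * ?C = ?C * embed H0 + scalar_endo (ih * lam) * ?C"
    by (simp add: operator_H0 operator_component distrib_right mult.assoc)
  then show ?thesis
    unfolding letter_def central_left_commute[OF endo.\<iota>_central, of "embed H0"]
      central_left_commute[OF endo.\<iota>_central, of "scalar_endo (ih * lam)"]
    by (simp add: distrib_left mult.assoc)
qed

lemma H0_word_prod:
  "embed H0 * word_prod letter w = word_prod letter w * embed H0 + scalar_endo (ih * sum_list w) * word_prod letter w"
proof -
  have "scalar_endo (ih * sum_list w) = sum_list (map (\<lambda>lam. scalar_endo (ih * lam) :: 'h endo) w)"
    by (induction w) (simp_all add: distrib_left endo.\<iota>_add)
  then show ?thesis
    using word_prod_eigen[of w "embed H0" letter "\<lambda>lam. scalar_endo (ih * lam)"]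
    by (simp add: H0_letter endo.\<iota>_central)
qed

text \<open>The commutator with \<open>H0\<close> multiplies a word by \<open>ih\<close> times the
  sum of its letters: it realizes \<nabla> on operator series.\<close>

lemma H0_series:
  "fps_const (embed H0) * series c =
   series c * fps_const (embed H0) + fps_const (scalar_endo ih) * series (\<lambda>w. sum_list w * c w)"
proof (rule fps_ext)
  fix n
  have "embed H0 * (scalar_endo (c w) * word_prod letter w) =
     scalar_endo (c w) * word_prod letter w * embed H0 +
     scalar_endo ih * (scalar_endo (sum_list w * c w) * word_prod letter w)" for w
  proof -
    have "embed H0 * (scalar_endo (c w) * word_prod letter w) =
        scalar_endo (c w) * (embed H0 * word_prod letter w)"
      by (rule central_left_commute) (rule endo.\<iota>_central)
    also have "\<dots> = scalar_endo (c w) * word_prod letter w * embed H0 +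
        scalar_endo (c w * (ih * sum_list w)) * word_prod letter w"
      by (simp add: H0_word_prod distrib_left mult.assoc endo.\<iota>_mult)
    also have "c w * (ih * sum_list w) = ih * (sum_list w * c w)"
      by simp
    finally show ?thesis by (simp add: endo.\<iota>_mult mult.assoc)
  qed
  then show "fps_nth (fps_const (embed H0) * series c) n =
    fps_nth (series c * fps_const (embed H0) + fps_const (scalar_endo ih) * series (\<lambda>w. sum_list w * c w)) n"
    by (simp add: series_nth sum_distrib_left sum_distrib_right sum.distrib)
qed

lemma letter_corner: "letter lam * corner_unit = letter lam" "corner_unit * letter lam = letter lam"
  by (simp_all add: letter_def operator_component mult.assoc
      central_left_commute[OF endo.\<iota>_central, of corner_unit])

text \<open>The empty word contributes a multiple of 1, which \<open>corner_unit\<close> does not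
  absorb; invariance of \<open>S\<close> is therefore expressed by commutation.\<close>

lemma series_commutes_corner:
  "series c * fps_const corner_unit = fps_const corner_unit * series c"
proof (rule fps_ext)
  fix n
  have w: "word_prod letter w * corner_unit = corner_unit * word_prod letter w" for w
  proof (induction w)
    case (Cons a w)
    have "word_prod letter (a # w) * corner_unit = letter a * corner_unit * word_prod letter w"
      by (simp add: mult.assoc Cons)
    then show ?case by (simp add: letter_corner mult.assoc[symmetric])
  qed simp
  show "fps_nth (series c * fps_const corner_unit) n = fps_nth (fps_const corner_unit * series c) n"
    by (simp add: series_nth sum_distrib_left sum_distrib_right mult.assoc w
        central_left_commute[OF endo.\<iota>_central, of corner_unit])
qed

lemma nested_commutator_eq:
  assumes "w \<noteq> []" "x \<in> S"
  shows "nested_commutator hbar (map component w) x = endo_apply (scalar_endo ih * nested_bracket letter w) x"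
    and "nested_commutator hbar (map component w) x \<in> S"
proof -
  have "\<forall>x\<in>S. nested_commutator hbar (map component w) x = endo_apply (scalar_endo ih * nested_bracket letter w) x
      \<and> nested_commutator hbar (map component w) x \<in> S"
    using assms(1)
  proof (induction w rule: induct_list012)
    case (2 a)
    then show ?case
      using operator_component operator_closed by (simp add: letter_def)
  next
    case (3 a b w)
    let ?D = "nested_commutator hbar (map component (b # w))"
    have IH: "endo_apply (nested_bracket letter (b # w)) x = (1 / ih) *\<^sub>C ?D x" "?D x \<in> S" if "x \<in> S" for x
      using 3 that by auto
    show ?case
    proof (intro ballI conjI)
      fix x assume x: "x \<in> S"
      have c: "component a y \<in> S" if "y \<in> S" for y
        using that operator_component operator_closed by blast
      have s: "component a (z *\<^sub>C y) = z *\<^sub>C component a y" if "y \<in> S" for z y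
        using that operator_component by (simp add: operator_def clinear_on_def)
      have t: "endo_apply (nested_bracket letter (b # w)) (z *\<^sub>C y) = z *\<^sub>C (1 / ih) *\<^sub>C ?D y" if "y \<in> S" for y z
        using IH that by (simp add: endo_apply_linear(2))
      show "nested_commutator hbar (map component (a # b # w)) x =
          endo_apply (scalar_endo ih * nested_bracket letter (a # b # w)) x"
        using x c IH(2)[OF x]
        by (simp add: letter_def IH(1)[OF x] t s operator_component S_scale commutator_def ih_def[symmetric]
            complex_vector.scale_right_diff_distrib scaleC_scaleC)
      show "nested_commutator hbar (map component (a # b # w)) x \<in> S"
        using x c IH(2) by (simp add: commutator_def S_scale S_diff)
    qed
  qed simp
  then show "nested_commutator hbar (map component w) x = endo_apply (scalar_endo ih * nested_bracket letter w) x"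
    and "nested_commutator hbar (map component w) x \<in> S"
    using assms(2) by auto
qed

end

section \<open>Identification of the mould series with the normal form\<close>

locale perturbed_birkhoff = perturbed J E0 e H0 hbar V + birkhoff "frequencies hbar J E0" Uplus Uminus
  for J E0 and e :: "nat \<Rightarrow> 'h::chilbert_space" and H0 hbar V Uplus Uminus
begin

definition nf_series :: "'h endo fps" where
  "nf_series = fps_const (scalar_endo ih) * series nf_mould"

lemma nf_series_0 [simp]: "fps_nth nf_series 0 = 0"
  by (simp add: nf_series_def series_nth)

text \<open>The image of \<open>gauge_mould_equation\<close>: \<nabla> becomes the commutator with
  \<open>H0\<close>, and \<open>letter_mould\<close> becomes the perturbation.\<close>

lemma gauge_conjugation:
  "(fps_const (embed H0) + nf_series) * series gauge_mould =
   series gauge_mould * (fps_const (embed H0) + fps_X * fps_const (embed V))"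
proof -
  let ?i = "fps_const (scalar_endo ih) :: 'h endo fps"
  have "series (\<lambda>w. sum_list w * gauge_mould w) =
      series (\<lambda>w. cmul gauge_mould letter_mould w - cmul nf_mould gauge_mould w)"
    by (rule series_cong) (rule gauge_mould_equation)
  also have "\<dots> = series gauge_mould * series letter_mould - series nf_mould * series gauge_mould"
    by (simp add: series_diff series_cmul)
  finally have "?i * series (\<lambda>w. sum_list w * gauge_mould w) =
      ?i * (series gauge_mould * series letter_mould) - nf_series * series gauge_mould"
    by (simp add: right_diff_distrib nf_series_def mult.assoc)
  also have "?i * (series gauge_mould * series letter_mould) = series gauge_mould * (?i * series letter_mould)"
  proof (rule central_left_commute[symmetric])
    show "?i * F = F * ?i" for F
      by (rule fps_ext) (simp add: endo.\<iota>_central)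
  qed
  finally show ?thesis
    unfolding series_letter_mould
    using H0_series[of gauge_mould] by (simp add: distrib_left distrib_right)
qed

text \<open>\<open>nf_mould\<close> lives on words of sum zero, and their products commute with
  \<open>H0\<close>.\<close>

lemma nf_series_commutes_H0: "embed H0 * fps_nth nf_series k = fps_nth nf_series k * embed H0"
proof -
  have "series (\<lambda>w. sum_list w * nf_mould w) = series (\<lambda>w. 0)"
    by (rule series_cong) (use nf_mould_resonant in fastforce)
  also have "\<dots> = 0" by (rule fps_ext) (simp add: series_nth)
  finally have "fps_const (embed H0) * series nf_mould = series nf_mould * fps_const (embed H0)"
    using H0_series[of nf_mould] by simp
  then have "embed H0 * fps_nth (series nf_mould) k = fps_nth (series nf_mould) k * embed H0"
    by (metis fps_mult_left_const_nth fps_mult_right_const_nth)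
  then show ?thesis
    by (simp add: nf_series_def central_left_commute[OF endo.\<iota>_central, of "embed H0"] mult.assoc)
qed

lemma nf_series_commutes_corner:
  "fps_nth nf_series k * corner_unit = corner_unit * fps_nth nf_series k"
proof -
  have "fps_nth (series nf_mould) k * corner_unit = corner_unit * fps_nth (series nf_mould) k"
    by (metis fps_mult_left_const_nth fps_mult_right_const_nth series_commutes_corner)
  then show ?thesis
    by (simp add: nf_series_def central_left_commute[OF endo.\<iota>_central, of corner_unit] mult.assoc)
qed

lemma nf_series_eigen:
  assumes n: "n \<in> J"
  shows "endo_apply (fps_nth nf_series k) (e n) = cinner (e n) (endo_apply (fps_nth nf_series k) (e n)) *\<^sub>C e n"
proof (rule commuting_diagonal[OF _ _ n])
  show "operator (endo_apply (fps_nth nf_series k))"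
    using commutes_corner_closed[OF nf_series_commutes_corner]
    by (auto simp: operator_def clinear_on_def endo_apply_linear)
  fix x assume x: "x \<in> S"
  have "endo_apply (embed H0 * fps_nth nf_series k) x = endo_apply (fps_nth nf_series k * embed H0) x"
    by (simp only: nf_series_commutes_H0)
  then show "H0 (endo_apply (fps_nth nf_series k) x) = endo_apply (fps_nth nf_series k) (H0 x)"
    using x commutes_corner_closed[OF nf_series_commutes_corner x] by (simp add: operator_H0)
qed

text \<open>As \<open>coeff\<close> is alternal, \<open>k\<close> times each word may be replaced by
  its nested bracket; this \<open>k\<close> is the length factor of \<open>nf_mould\<close>.\<close>

lemma nf_series_nested_commutators:
  assumes x: "x \<in> S" and k: "k \<ge> 1"
  shows "endo_apply (fps_nth nf_series k) x =
    (\<Sum>w\<in>words band k. coeff w *\<^sub>C nested_commutator hbar (map component w) x)"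
proof -
  have "shuffle_sum (\<lambda>w. scalar_endo (coeff w) :: 'h endo) u v = 0"
    if "u \<in> lists band" "v \<in> lists band" "u \<noteq> []" "v \<noteq> []" for u v
  proof -
    have "shuffle_sum (\<lambda>w. scalar_endo (coeff w) :: 'h endo) u v = scalar_endo (shuffle_sum coeff u v)"
      by (rule shuffle_sum_hom) (simp_all add: endo.\<iota>_add)
    moreover have "u \<in> lists (frequencies hbar J E0)" "v \<in> lists (frequencies hbar J E0)"
      using that band_subset by auto
    ultimately show ?thesis using that by (simp add: shuffle_sum_coeff)
  qed
  then have "(\<Sum>w\<in>words band k. scalar_endo (coeff w) * nested_bracket letter w) =
      (\<Sum>w\<in>words band k. scalar_endo (coeff w) * (of_nat k * word_prod letter w))"
    by (rule dynkin_specht_wever[OF finite_band'])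
  also have "\<dots> = fps_nth (series nf_mould) k"
    unfolding series_nth
  proof (rule sum.cong[OF refl])
    fix w assume "w \<in> words band k"
    then have "nf_mould w = coeff w * of_nat k" by (simp add: nf_mould_def words_def)
    then show "scalar_endo (coeff w) * (of_nat k * word_prod letter w) = scalar_endo (nf_mould w) * word_prod letter w"
      by (simp add: endo.\<iota>_mult endo.\<iota>_of_nat mult.assoc)
  qed
  finally have "fps_nth nf_series k = (\<Sum>w\<in>words band k. scalar_endo ih * (scalar_endo (coeff w) * nested_bracket letter w))"
    by (simp only: nf_series_def fps_mult_left_const_nth sum_distrib_left[symmetric])
  also have "\<dots> = (\<Sum>w\<in>words band k. scalar_endo (coeff w) * (scalar_endo ih * nested_bracket letter w))"
    by (intro sum.cong refl central_left_commute endo.\<iota>_central)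
  finally have "endo_apply (fps_nth nf_series k) x =
      (\<Sum>w\<in>words band k. coeff w *\<^sub>C endo_apply (scalar_endo ih * nested_bracket letter w) x)"
    by simp
  also have "\<dots> = (\<Sum>w\<in>words band k. coeff w *\<^sub>C nested_commutator hbar (map component w) x)"
  proof (rule sum.cong[OF refl])
    fix w assume "w \<in> words band k"
    then have "w \<noteq> []" using k by (auto simp: words_def)
    then show "coeff w *\<^sub>C endo_apply (scalar_endo ih * nested_bracket letter w) x =
        coeff w *\<^sub>C nested_commutator hbar (map component w) x"
      using nested_commutator_eq(1)[OF _ x] by simp
  qed
  finally show ?thesis .
qed

text \<open>A word with a letter outside \<open>band\<close> contains a zero operator and
  contributes nothing, so the sum over all of \<open>frequencies\<close> is finite.\<close>

lemma has_sum_nested_commutators: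
  assumes x: "x \<in> S" and k: "k \<ge> 1"
  shows "((\<lambda>w. coeff w *\<^sub>C nested_commutator hbar (map component w) x)
    has_sum endo_apply (fps_nth nf_series k) x) {w \<in> lists (frequencies hbar J E0). length w = k}"
proof -
  let ?f = "\<lambda>w. coeff w *\<^sub>C nested_commutator hbar (map component w) x"
  have "?f w = 0" if "w \<in> lists (frequencies hbar J E0)" "length w = k" "w \<notin> words band k" for w
  proof -
    have "\<exists>a\<in>set w. a \<notin> band"
      using that by (auto simp: words_def in_lists_conv_set)
    then obtain a where a: "a \<in> set w" "a \<notin> band" by blast
    then have a': "a \<in> frequencies hbar J E0" using that(1) by auto
    have "embed (component a) * corner_unit = 0 * corner_unit"
      by (rule mult_corner_eqI) (simp add: operator_component component_outside_band a a')
    then have "letter a = 0" by (simp add: letter_def operator_component)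
    then have "nested_bracket letter w = 0" by (rule nested_bracket_eq_0[OF a(1)])
    moreover have "w \<noteq> []" using a by auto
    ultimately show ?thesis using x by (simp add: nested_commutator_eq)
  qed
  moreover have "words band k \<subseteq> {w \<in> lists (frequencies hbar J E0). length w = k}"
    using band_subset by (auto simp: words_def)
  ultimately have "(?f has_sum sum ?f (words band k)) {w \<in> lists (frequencies hbar J E0). length w = k}
     \<longleftrightarrow> (?f has_sum sum ?f (words band k)) (words band k)"
    by (intro has_sum_cong_neutral) auto
  then show ?thesis
    using nf_series_nested_commutators[OF x k] by (simp add: has_sum_finite)
qed

text \<open>The exponential \<open>X\<close> of \<open>W\<close> and the gauge series
  \<open>G\<close> both conjugate the perturbed operator to a normal form. So \<open>X\<close> times
  the inverse of \<open>G\<close> intertwines the two normal forms, and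
  \<open>normal_form_unique\<close> applies.\<close>

lemma normal_form_eq_nf_series:
  assumes nf: "is_normal_form hbar S H0 V W N" and k: "k \<ge> 1" and x: "x \<in> S"
  shows "N k x = endo_apply (fps_nth nf_series k) x"
proof -
  have W0: "W 0 y = 0" and N0: "N 0 y = 0" for y
    using nf by (auto simp: is_normal_form_def)
  have opW: "operator (W j)" and opN: "operator (N j)" for j
    using nf W0 N0 by (cases "j = 0"; auto simp: is_normal_form_def operator_def clinear_on_def)+
  define Ws where "Ws = fps_const (scalar_endo (1 / ih)) * Abs_fps (\<lambda>j. embed (W j))"
  define Ns where "Ns = Abs_fps (\<lambda>j. embed (N j))"
  define p where "p = fps_const corner_unit"
  let ?h = "fps_const (embed H0)" and ?v = "fps_X * fps_const (embed V)"
  have embed_0: "embed A = 0" if "\<And>y. A y = 0" for A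
  proof -
    have "operator A" using that by (auto simp: operator_def clinear_on_def)
    then have "embed A * corner_unit = 0 * corner_unit"
      by (intro mult_corner_eqI) (simp add: that)
    then show ?thesis using \<open>operator A\<close> by simp
  qed
  have Ws0: "fps_nth Ws 0 = 0" by (simp add: Ws_def embed_0 W0)
  have Ns0: "fps_nth Ns 0 = 0" by (simp add: Ns_def embed_0 N0)
  have rW: "represents (Abs_fps (\<lambda>j. embed (W j))) W"
    by (simp add: represents_def opW operator_closed)
  have r1: "represents Ws (ser_scale (1 / ih) W)"
    unfolding Ws_def by (rule represents_scale[OF rW])
  have mWs: "- Ws = fps_const (scalar_endo (- 1 / ih)) * Abs_fps (\<lambda>j. embed (W j))"
    by (rule fps_ext) (simp add: Ws_def endo.\<iota>_minus)
  have r2: "represents (- Ws) (ser_scale (- 1 / ih) W)"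
    unfolding mWs by (rule represents_scale[OF rW])
  have r3: "represents (?h + ?v) (perturbed_series H0 V)"
    by (auto simp: represents_def perturbed_series_def operator_H0 operator_V operator_closed)
  define X where "X = endo.fexp Ws"
  define X' where "X' = endo.fexp (- Ws)"
  have rep: "represents (X * (?h + ?v) * X')
      (ser_mult (ser_mult (ser_exp (ser_scale (1 / ih) W)) (perturbed_series H0 V)) (ser_exp (ser_scale (- 1 / ih) W)))"
    unfolding X_def X'_def by (intro represents_mult represents_exp r1 r2 r3)
  have pW: "Ws * p = Ws" "p * Ws = Ws"
    by (rule fps_ext; simp add: Ws_def p_def opW mult.assoc
        central_left_commute[OF endo.\<iota>_central, of corner_unit])+
  have pfexp: "endo.fexp F * p = p * endo.fexp F" if "F * p = p * F" for F :: "'h endo fps"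
  proof (rule fps_ext)
    fix n
    have "(F ^ j) * p = p * F ^ j" for j
      by (rule power_commuting_commutes) (rule that)
    then have "fps_nth (F ^ j * p) n = fps_nth (p * F ^ j) n" for j by simp
    then have "fps_nth (F ^ j) n * corner_unit = corner_unit * fps_nth (F ^ j) n" for j
      by (simp add: p_def)
    then show "fps_nth (endo.fexp F * p) n = fps_nth (p * endo.fexp F) n"
      by (simp add: endo.fexp_def p_def sum_distrib_left sum_distrib_right mult.assoc
        central_left_commute[OF endo.\<iota>_central, of corner_unit])
  qed
  have pX: "X * p = p * X" and pX': "X' * p = p * X'"
    unfolding X_def X'_def by (rule pfexp; simp add: pW)+
  have hp: "(?h + ?v) * p = ?h + ?v" "p * (?h + ?v) = ?h + ?v"
    by (rule fps_ext; auto simp: p_def operator_H0 operator_V distrib_left distrib_right)+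
  have Np: "(?h + Ns) * p = ?h + Ns"
    by (rule fps_ext) (simp add: p_def operator_H0 Ns_def opN distrib_right)
  \<comment> \<open>The normal form equation is only known on \<open>S\<close>; right multiplication
    by \<open>p\<close> makes it an identity of series, after which \<open>p\<close> is absorbed
    again.\<close>
  have "X * (?h + ?v) * X' * p = (?h + Ns) * p"
  proof (rule fps_ext)
    fix n
    have "fps_nth (X * (?h + ?v) * X') n * corner_unit = fps_nth (?h + Ns) n * corner_unit"
    proof (rule mult_corner_eqI)
      fix y assume y: "y \<in> S"
      have "endo_apply (fps_nth (X * (?h + ?v) * X') n) y = (if n = 0 then H0 y else N n y)"
        using rep nf y by (simp add: represents_def is_normal_form_def ih_def)
      then show "endo_apply (fps_nth (X * (?h + ?v) * X') n) y = endo_apply (fps_nth (?h + Ns) n) y"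
        using y by (auto simp: Ns_def operator_H0 opN N0)
    qed
    then show "fps_nth (X * (?h + ?v) * X' * p) n = fps_nth ((?h + Ns) * p) n"
      by (simp add: p_def)
  qed
  also have "X * (?h + ?v) * X' * p = X * (?h + ?v) * X'"
    by (simp only: mult.assoc pX' ) (simp only: mult.assoc[symmetric] hp)
  finally have conj: "X * (?h + ?v) * X' = ?h + Ns" by (simp only: Np)
  have XX: "X' * X = 1"
    using endo.fexp_mult_fexp_minus[of "- Ws"] Ws0 by (simp add: X_def X'_def)
  define G where "G = series gauge_mould"
  \<comment> \<open>The empty word gives \<open>G\<close> the constant term 1, so this inverse is
    two-sided.\<close>
  define R where "R = fps_right_inverse G 1"
  have G0: "fps_nth G 0 = 1" by (simp add: G_def series_nth)
  have GR: "G * R = 1" and RG: "R * G = 1"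
    unfolding R_def using fps_right_inverse[of G 1] fps_left_inverse'[of 1 G 1] G0 by simp_all
  have pG: "G * p = p * G" unfolding G_def p_def by (rule series_commutes_corner)
  have pR: "R * p = p * R"
  proof -
    have "R * p = R * (p * G) * R" by (simp add: mult.assoc GR)
    also have "\<dots> = R * G * p * R" by (simp add: pG[symmetric] mult.assoc)
    finally show ?thesis by (simp add: RG)
  qed
  define Y where "Y = X * R"
  have "Y * (?h + nf_series) = Y * ((?h + nf_series) * G) * R"
    by (simp add: mult.assoc GR)
  also have "\<dots> = X * (R * G) * (?h + ?v) * R"
    unfolding G_def[symmetric] gauge_conjugation[folded G_def] Y_def by (simp only: mult.assoc)
  also have "\<dots> = X * (?h + ?v) * (X' * X) * R"
    by (simp only: RG XX mult_1_right)
  also have "\<dots> = X * (?h + ?v) * X' * Y"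
    unfolding Y_def by (simp only: mult.assoc)
  finally have eq: "Y * (?h + nf_series) = (?h + Ns) * Y" by (simp only: conj)
  have pY: "Y * p = p * Y"
    by (simp add: Y_def mult.assoc pR) (simp add: mult.assoc[symmetric] pX)
  have closed: "endo_apply (fps_nth Y j) y \<in> S" if "y \<in> S" for j y
  proof (rule commutes_corner_closed[OF _ that])
    have "fps_nth (Y * p) j = fps_nth (p * Y) j" by (simp only: pY)
    then show "fps_nth Y j * corner_unit = corner_unit * fps_nth Y j" by (simp add: p_def)
  qed
  have Y0: "fps_nth Y 0 = 1"
    by (simp add: Y_def X_def R_def endo.fexp_def)
  have commN: "H0 (N j y) = N j (H0 y)" if "y \<in> S" for j y
    using nf that N0 clinear_on_0[OF linear_H0] unfolding is_normal_form_def commutator_def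
    by (cases "j = 0") auto
  have basis: "endo_apply (fps_nth nf_series k) (e n) = N k (e n)" if n: "n \<in> J" for n
  proof -
    have "endo_apply (fps_nth nf_series k) (e n) = endo_apply (fps_nth Ns k) (e n)"
    proof (rule normal_form_unique[OF eq Y0 nf_series_0 Ns0 closed nf_series_eigen _ n])
      show "endo_apply (fps_nth Ns j) (e m) = cinner (e m) (N j (e m)) *\<^sub>C e m" if "m \<in> J" for j m
        using commuting_diagonal[OF opN commN that] that by (simp add: Ns_def opN)
    qed
    then show ?thesis by (simp add: Ns_def opN n)
  qed
  show ?thesis
  proof (rule linear_on_S_eqI[OF _ _ _ x])
    show "clinear_on S (N k)" using opN by (simp add: operator_def)
    show "clinear_on S (endo_apply (fps_nth nf_series k))"
      by (simp add: clinear_on_def endo_apply_linear)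
  qed (simp add: basis)
qed

end

theorem theorem1:
  fixes hbar :: real and J :: "nat set" and E0 :: "nat \<Rightarrow> real"
    and e :: "nat \<Rightarrow> 'h::chilbert_space" and D :: "'h set" and H0 V :: "'h \<Rightarrow> 'h"
    and W N :: "'h opseries" and Uplus Uminus :: mould and k :: nat
  assumes "hbar > 0"
    and "self_adjoint_on D H0"
    and "discrete_nondegenerate_spectrum D H0 J E0 e"
    and "bounded_self_adjoint V"
    and "finite {lam \<in> frequencies hbar J E0.
           \<exists>x\<in>cspan (e ` J). hom_component hbar J E0 e V lam x \<noteq> 0}"
    and "is_normal_form hbar (cspan (e ` J)) H0 V W N"
    and "is_birkhoff_decomposition (frequencies hbar J E0) T_mould Uplus Uminus"
    and "k \<ge> 1"
  shows "(\<forall>x\<in>cspan (e ` J).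
            ((\<lambda>w. (- fls_residue (Uminus w)) *\<^sub>C
                    nested_commutator hbar (map (hom_component hbar J E0 e V) w) x)
             has_sum N k x) {w \<in> lists (frequencies hbar J E0). length w = k}) \<and>
         (\<forall>w\<in>lists (frequencies hbar J E0). length w = k \<longrightarrow>
            fls_X * Uminus w \<in> {f. \<forall>n>0. f $$ n = 0} \<and>
            - fls_residue (Uminus w) = - eval_at_infinity (fls_X * Uminus w))"
proof -
  have sp: "inj_on E0 J" "orthonormal_basis_on J e"
    "\<And>n. n \<in> J \<Longrightarrow> e n \<in> D \<and> H0 (e n) = complex_of_real (E0 n) *\<^sub>C e n"
    using assms(3) by (auto simp: discrete_nondegenerate_spectrum_def)
  have D: "csubspace D" "clinear_on D H0"
    using assms(2) by (auto simp: self_adjoint_on_def)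
  have "cspan (e ` J) \<subseteq> D"
    using sp(3) by (intro complex_vector.span_minimal D(1)) auto
  then have lin: "clinear_on (cspan (e ` J)) H0"
    using D(2) unfolding clinear_on_def by blast
  interpret perturbed_birkhoff J E0 e H0 hbar V Uplus Uminus
  proof
    show "m \<in> J \<Longrightarrow> n \<in> J \<Longrightarrow> cinner (e m) (e n) = (if m = n then 1 else 0)" for m n
      using sp(2) by (simp add: orthonormal_basis_on_def)
    show "closure (cspan (e ` J)) = UNIV"
      using sp(2) by (simp add: orthonormal_basis_on_def)
    show "clinear_on UNIV V" using assms(4) by (simp add: bounded_self_adjoint_def)
  qed (use assms(1,5,7) sp lin in auto)
  show ?thesis
  proof (intro conjI ballI impI)
    fix x assume "x \<in> cspan (e ` J)"
    then show "((\<lambda>w. (- fls_residue (Uminus w)) *\<^sub>C nested_commutator hbar (map component w) x)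
        has_sum N k x) {w \<in> lists (frequencies hbar J E0). length w = k}"
      using has_sum_nested_commutators[OF _ assms(8)] normal_form_eq_nf_series[OF assms(6,8)]
      by (simp only: coeff_def)
  next
    fix w assume w: "w \<in> lists (frequencies hbar J E0)" "length w = k"
    \<comment> \<open>The word is nonempty as \<open>k \<ge> 1\<close>. Multiplication by \<epsilon>
      raises exponents by one: no positive power appears, and the constant term is the
      residue.\<close>
    then have "Uminus w \<in> K_minus" using assms(8) by (intro Uminus_K_minus) auto
    then show "fls_X * Uminus w \<in> {f. \<forall>n>0. f $$ n = 0}"
      by (simp add: K_minus_def)
    show "- fls_residue (Uminus w) = - eval_at_infinity (fls_X * Uminus w)"
      by (simp add: eval_at_infinity_def)
  qed
qed

end
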